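(* Let $T$ be a tree that is not a star. Then $\gamma'_t(T)=2\gamma'(T)$ if and only if $T\in\mathcal{T}$ (i.e. $T$ admits a vertex labelling with labels $C$, $L$ such that the labelled tree belongs to $\mathcal{T}$).
   Context: Graphs are finite, undirected, connected, without loops or multiple edges. Two distinct edges are adjacent if they share an endpoint. For a graph $G=(V,E)$, $F\subseteq E$ is an edge dominating set if every edge in $E\setminus F$ is adjacent to at least one edge of $F$, and a total edge dominating set if every edge in $E$ is adjacent to at least one edge of $F$. $\gamma'(G)$ and $\gamma'_t(G)$ are the minimum cardinalities of an edge dominating set and of a total edge dominating set of $G$, respectively. A leaf is a vertex of degree one. For a positive integer $k$, a star $S_{1,k}$ is a tree that contains exactly one non-leaf vertex (its center) and $k$ leaves. $P_4$ is the path with four vertices. The distance between a vertex $v$ and an edge $e$ is the smaller of the distances from $v$ to the endpoints of $e$. $N(w)$ is the open neighborhood of $w$. The labelled $P_4$ is $P_4$ with its two leaves labelled $L$ and its two other vertices labelled $C$. Write $l(v)$ for the label of $v$. A $C-C$ edge is an edge with both endpoints labelled $C$. $\mathcal{T}$ is the family of vertex-labelled trees that contains the labelled $P_4$ as the initial labelled tree and is constructed inductively by the following two operations, each building a bigger labelled tree $T'$ from a labelled tree $T\in\mathcal{T}$. Operation $\mathcal{O}_1$: Let $v$ be a vertex of $T$ with $l(v)=L$ such that (1) each vertex labelled $C$ at distance $2$ from $v$ is adjacent to a leaf; and (2) for any $C-C$ edge $wu$ at distance $1$ from $v$, with $v$ adjacent to $u$, either $u$ has a leaf neighbor other than $v$,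 or all vertices of $N(w)\setminus\{u\}$ are leaves. Construct $T'$ from $T$ and a (disjoint) labelled $P_4$ by identifying $v$ with a leaf of the $P_4$, labelling the identified vertex $L$, and keeping the labels of all other vertices unchanged. Operation $\mathcal{O}_2$: Let $v$ be a vertex of $T$ with $l(v)=C$. Construct $T'$ from $T$ by adding a new vertex $u$ adjacent to $v$, labelling $u$ as $L$, and keeping the labels of all other vertices unchanged.
   Formalization: The tree T is assumed to have at least two vertices; for the one-vertex tree (not a star, no edges) both numbers are 0, so the equality holds although the tree is not in the family. *)

theory Defs
  imports "HOL-Library.Extended_Nat"
begin

text \<open>
  A graph is given by a vertex set \<open>V\<close> and a set \<open>E\<close> of two-element subsets of \<open>V\<close>.
\<close>

definition simple_graph :: "'a set \<Rightarrow> 'a set set \<Rightarrow> bool" where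
  "simple_graph V E \<longleftrightarrow> finite V \<and> (\<forall>e\<in>E. e \<subseteq> V \<and> card e = 2)"

definition nbhd :: "'a set set \<Rightarrow> 'a \<Rightarrow> 'a set" where
  "nbhd E v = {u. {v, u} \<in> E \<and> u \<noteq> v}"

definition is_leaf :: "'a set set \<Rightarrow> 'a \<Rightarrow> bool" where
  "is_leaf E v \<longleftrightarrow> card (nbhd E v) = 1"

definition walk :: "'a set \<Rightarrow> 'a set set \<Rightarrow> 'a list \<Rightarrow> bool" where
  "walk V E p \<longleftrightarrow> p \<noteq> [] \<and> set p \<subseteq> V \<and> successively (\<lambda>x y. {x, y} \<in> E) p"

definition connected_graph :: "'a set \<Rightarrow> 'a set set \<Rightarrow> bool" where
  "connected_graph V E \<longleftrightarrow>
     V \<noteq> {} \<and> (\<forall>u\<in>V. \<forall>v\<in>V. \<exists>p. walk V E p \<and> hd p = u \<and> last p = v)"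

text \<open>The closing edge of a cycle joins the last vertex of the list to the first.\<close>

definition cycle :: "'a set \<Rightarrow> 'a set set \<Rightarrow> 'a list \<Rightarrow> bool" where
  "cycle V E p \<longleftrightarrow> walk V E p \<and> distinct p \<and> length p \<ge> 3 \<and> {last p, hd p} \<in> E"

definition tree :: "'a set \<Rightarrow> 'a set set \<Rightarrow> bool" where
  "tree V E \<longleftrightarrow> simple_graph V E \<and> connected_graph V E \<and> (\<nexists>p. cycle V E p)"

text \<open>
  Read literally, this gives the stars with at least two edges; in the one-edge tree both
  vertices are leaves, so it does not count as a star here.
\<close>

definition star :: "'a set \<Rightarrow> 'a set set \<Rightarrow> bool" where
  "star V E \<longleftrightarrow> tree V E \<and> (\<exists>!c. c \<in> V \<and> \<not> is_leaf E c) \<and>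
     (\<exists>k>0. card {v \<in> V. is_leaf E v} = k)"

text \<open>The value is only meaningful for vertices joined by some walk.\<close>

definition vdist :: "'a set \<Rightarrow> 'a set set \<Rightarrow> 'a \<Rightarrow> 'a \<Rightarrow> nat" where
  "vdist V E u v = (LEAST n. \<exists>p. walk V E p \<and> hd p = u \<and> last p = v \<and> length p = Suc n)"

definition edge_dist :: "'a set \<Rightarrow> 'a set set \<Rightarrow> 'a \<Rightarrow> 'a set \<Rightarrow> nat" where
  "edge_dist V E v e = Min (vdist V E v ` e)"

definition adjacent_edges :: "'a set \<Rightarrow> 'a set \<Rightarrow> bool" where
  "adjacent_edges e f \<longleftrightarrow> e \<noteq> f \<and> e \<inter> f \<noteq> {}"

definition edge_dominating_set :: "'a set set \<Rightarrow> 'a set set \<Rightarrow> bool" where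
  "edge_dominating_set E F \<longleftrightarrow> F \<subseteq> E \<and> (\<forall>e\<in>E - F. \<exists>f\<in>F. adjacent_edges e f)"

definition total_edge_dominating_set :: "'a set set \<Rightarrow> 'a set set \<Rightarrow> bool" where
  "total_edge_dominating_set E F \<longleftrightarrow> F \<subseteq> E \<and> (\<forall>e\<in>E. \<exists>f\<in>F. adjacent_edges e f)"

text \<open>
  A graph with an edge adjacent to no other edge has no total edge dominating set; its total
  edge domination number is the infimum of the empty set, \<open>\<infinity>\<close>.
\<close>

definition edge_domination_number :: "'a set set \<Rightarrow> enat" where
  "edge_domination_number E = Inf {enat (card F) |F. edge_dominating_set E F}"

definition total_edge_domination_number :: "'a set set \<Rightarrow> enat" where
  "total_edge_domination_number E = Inf {enat (card F) |F. total_edge_dominating_set E F}"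

datatype label = L | C

definition O1_condition :: "'a set \<Rightarrow> 'a set set \<Rightarrow> ('a \<Rightarrow> label) \<Rightarrow> 'a \<Rightarrow> bool" where
  "O1_condition V E l v \<longleftrightarrow>
     (\<forall>x\<in>V. l x = C \<and> vdist V E v x = 2 \<longrightarrow> (\<exists>y\<in>nbhd E x. is_leaf E y)) \<and>
     (\<forall>w\<in>V. \<forall>u\<in>V. {w, u} \<in> E \<and> l w = C \<and> l u = C \<and> edge_dist V E v {w, u} = 1 \<and> {v, u} \<in> E \<longrightarrow>
        (\<exists>y\<in>nbhd E u. y \<noteq> v \<and> is_leaf E y) \<or> (\<forall>y\<in>nbhd E w - {u}. is_leaf E y))"

text \<open>
  The family of labelled trees, with vertices drawn from the type \<open>'a\<close>. Only the labels of the
  vertices in \<open>V\<close> matter. Because the names of the new vertices are arbitrary, the family is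
  closed under label-preserving isomorphism. In \<open>O1\<close> the added path is \<open>v - b - c - d\<close>, its
  leaf \<open>v\<close> being the identified vertex.
\<close>

inductive labelled_family :: "'a set \<Rightarrow> 'a set set \<Rightarrow> ('a \<Rightarrow> label) \<Rightarrow> bool" where
  P4: "labelled_family {a, b, c, d} {{a, b}, {b, c}, {c, d}} l"
    if "distinct [a, b, c, d]" "l a = L" "l b = C" "l c = C" "l d = L"
| O1: "labelled_family (V \<union> {b, c, d}) (E \<union> {{v, b}, {b, c}, {c, d}}) (l(b := C, c := C, d := L))"
    if "labelled_family V E l" "v \<in> V" "l v = L" "O1_condition V E l v"
       "distinct [b, c, d]" "{b, c, d} \<inter> V = {}"
| O2: "labelled_family (insert u V) (insert {v, u} E) (l(u := L))"
    if "labelled_family V E l" "v \<in> V" "l v = C" "u \<notin> V"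

end

theory Submission
  imports Defs
begin

text \<open>
  Adding to every edge of an edge dominating set \<open>F\<close> some adjacent edge, its partner, gives a total
  edge dominating set of at most twice the size. Hence the equation says that total
  edge dominating sets exist and none is smaller than \<open>2 |F|\<close> for a minimum \<open>F\<close>; such an \<open>F\<close> is
  called sharp below (\<open>sharp_exists_iff\<close>), and the theorem is that a tree that is not a star has a sharp set iff
  it can be labelled as a member of the family.

  In a member of the family the edges joining two vertices labelled \<open>C\<close> (the spine) dominate all
  edges, and each operation keeps every total edge dominating set at least twice as large as the
  spine (\<open>family_lower_bound\<close>). For a path attached at \<open>v\<close>, such a set uses two edges of the new
  path, and what remains dominates every old edge that misses \<open>v\<close>. The side conditions of the
  operation permit to exchange edges for spine edges until the edges at \<open>v\<close> are dominated as well,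
  without using more edges (\<open>dominate_edges_at_vertex\<close>).

  Conversely let \<open>F\<close> be sharp. For every choice of partners the bound \<open>2 |F|\<close> is attained, so partners are
  pairwise different and outside \<open>F\<close> (\<open>sharp_partners\<close>). Therefore \<open>F\<close> is a matching, any edge inside
  its vertex set belongs to \<open>F\<close>, and the other vertices are independent. Label the vertices
  of \<open>F\<close> by \<open>C\<close> and the others by \<open>L\<close>. Since the tree is not a star, every \<open>C\<close> vertex has an \<open>L\<close>
  neighbour (\<open>outer_neighbour\<close>), so the tree consists of double stars glued together at \<open>L\<close> vertices.
  Rooting the tree at such a vertex \<open>v\<close> and choosing as partner of each \<open>f \<in> F\<close> the edge that leads
  from \<open>f\<close> towards \<open>v\<close>, one finds a total edge dominating set with fewer than \<open>2 |F|\<close> edges as soon as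
  a side condition of the first operation fails at \<open>v\<close> (\<open>leaves_near_outer_vertex\<close>). So the
  double stars can be attached one after the other, those nearer to a fixed root first
  (\<open>family_edges_at\<close>).
\<close>

section \<open>Edges as pairs\<close>

lemma adjacent_pairI: "y \<noteq> z \<Longrightarrow> adjacent_edges {x, y} {x, z}"
  by (auto simp: adjacent_edges_def doubleton_eq_iff)

lemma card2_other_end:
  assumes "card f = 2" "x \<in> f"
  obtains z where "f = {x, z}" "z \<noteq> x"
  using assms by (auto simp: card_2_iff)

lemma adjacent_pairE:
  assumes "adjacent_edges {x, y} f" "card f = 2"
  obtains z where "f = {x, z}" "z \<noteq> y" "z \<noteq> x" | z where "f = {y, z}" "z \<noteq> x" "z \<noteq> y"
proof -
  from assms(1) have ne: "{x, y} \<noteq> f" and "x \<in> f \<or> y \<in> f" by (auto simp: adjacent_edges_def)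
  then show ?thesis
  proof (elim disjE)
    assume "x \<in> f"
    then obtain z where z: "f = {x, z}" "z \<noteq> x" using assms(2) card2_other_end by metis
    moreover have "z \<noteq> y" using ne z(1) by metis
    ultimately show ?thesis using that(1) by metis
  next
    assume "y \<in> f"
    then obtain z where z: "f = {y, z}" "z \<noteq> y" using assms(2) card2_other_end by metis
    moreover have "z \<noteq> x" using ne z(1) by (metis insert_commute)
    ultimately show ?thesis using that(2) by metis
  qed
qed

lemma leaf_neighbour_unique:
  assumes "is_leaf E y" "{y, w} \<in> E" "{y, z} \<in> E" "w \<noteq> y" "z \<noteq> y"
  shows "w = z"
proof -
  obtain a where "nbhd E y = {a}" using assms(1) unfolding is_leaf_def by (rule card_1_singletonE)
  moreover have "w \<in> nbhd E y" "z \<in> nbhd E y" using assms by (simp_all add: nbhd_def)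
  ultimately show ?thesis by simp
qed

lemma not_leaf_other_neighbour:
  assumes "\<not> is_leaf E x" "{x, w} \<in> E" "w \<noteq> x"
  obtains y where "{x, y} \<in> E" "y \<noteq> x" "y \<noteq> w"
proof -
  have "w \<in> nbhd E x" using assms by (simp add: nbhd_def)
  moreover have "nbhd E x \<noteq> {w}" using assms(1) by (auto simp: is_leaf_def)
  ultimately show ?thesis using that by (auto simp: nbhd_def)
qed

section \<open>Walks and distances\<close>

lemma vdist_walk:
  assumes "walk V E p" "hd p = u" "last p = v"
  obtains q where "walk V E q" "hd q = u" "last q = v" "length q = Suc (vdist V E u v)"
proof -
  have "length p = Suc (length p - 1)" using assms(1) by (cases p) (auto simp: walk_def)
  then have "\<exists>n p. walk V E p \<and> hd p = u \<and> last p = v \<and> length p = Suc n" using assms by blast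
  from LeastI_ex[OF this] show ?thesis using that unfolding vdist_def by blast
qed

lemma vdist_le:
  assumes "walk V E p" "hd p = u" "last p = v" "length p \<le> Suc n"
  shows "vdist V E u v \<le> n"
proof -
  have l: "length p = Suc (length p - 1)" using assms(1) by (cases p) (auto simp: walk_def)
  have "vdist V E u v \<le> length p - 1"
    unfolding vdist_def by (rule Least_le) (use assms l in blast)
  with assms(4) show ?thesis by simp
qed

lemma walk_snoc:
  "walk V E (p @ [y]) \<longleftrightarrow> y \<in> V \<and> (p = [] \<or> walk V E p \<and> {last p, y} \<in> E)"
  by (auto simp: walk_def successively_append_iff)

lemma walk_Cons:
  "walk V E (y # p) \<longleftrightarrow> y \<in> V \<and> (p = [] \<or> walk V E p \<and> {y, hd p} \<in> E)"
  by (auto simp: walk_def successively_Cons)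

section \<open>Sharp edge dominating sets\<close>

text \<open>The last two conditions make \<open>F\<close> a minimum edge dominating set and force equality in the
  general bound by twice its size.\<close>

definition sharp :: "'a set set \<Rightarrow> 'a set set \<Rightarrow> bool" where
  "sharp E F \<longleftrightarrow> finite E \<and> (\<forall>e\<in>E. card e = 2) \<and> edge_dominating_set E F \<and>
     (\<forall>e\<in>E. \<exists>e'\<in>E. adjacent_edges e e') \<and>
     (\<forall>K. total_edge_dominating_set E K \<longrightarrow> 2 * card F \<le> card K)"

lemma total_of_partners:
  assumes "edge_dominating_set E F" "\<And>f. f \<in> F \<Longrightarrow> g f \<in> E \<and> adjacent_edges f (g f)"
  shows "total_edge_dominating_set E (F \<union> g ` F)"
  unfolding total_edge_dominating_set_def
proof (intro conjI ballI)
  show "F \<union> g ` F \<subseteq> E" using assms by (auto simp: edge_dominating_set_def)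
  fix e assume "e \<in> E"
  then show "\<exists>f\<in>F \<union> g ` F. adjacent_edges e f"
    using assms by (cases "e \<in> F") (auto simp: edge_dominating_set_def)
qed

text \<open>The edges of \<open>F\<close> and their partners form a total edge dominating set, which has fewer than \<open>2 |F|\<close>
  edges if two partners coincide or a partner lies in \<open>F\<close>.\<close>

lemma sharp_partners:
  assumes s: "sharp E F" and g: "\<And>f. f \<in> F \<Longrightarrow> g f \<in> E \<and> adjacent_edges f (g f)"
  shows "inj_on g F" "g ` F \<inter> F = {}"
proof -
  have F: "finite F" "edge_dominating_set E F"
    using s unfolding sharp_def edge_dominating_set_def by (auto intro: finite_subset)
  have le: "2 * card F \<le> card (F \<union> g ` F)"
    using s total_of_partners[OF F(2) g] by (auto simp: sharp_def)
  have ui: "card (F \<union> g ` F) + card (F \<inter> g ` F) = card F + card (g ` F)"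
    using F(1) card_Un_Int[of F "g ` F"] by simp
  have im: "card (g ` F) \<le> card F" using F(1) by (rule card_image_le)
  have "card (g ` F) = card F" "card (F \<inter> g ` F) = 0" using le ui im by auto
  then show "inj_on g F" "g ` F \<inter> F = {}" using F(1) by (auto simp: eq_card_imp_inj_on)
qed

lemma sharp_partner_fun:
  assumes "sharp E F"
  obtains g where "\<And>f. f \<in> F \<Longrightarrow> g f \<in> E \<and> adjacent_edges f (g f)"
proof -
  have "\<forall>f\<in>F. \<exists>e. e \<in> E \<and> adjacent_edges f e"
    using assms unfolding sharp_def edge_dominating_set_def by blast
  then show ?thesis using that by metis
qed

lemma Inf_enat_attained:
  fixes S :: "enat set"
  assumes "S \<noteq> {}"
  shows "Inf S \<in> S"
proof -
  obtain x where "x \<in> S" using assms by blast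
  then show ?thesis using LeastI[of "\<lambda>x. x \<in> S" x] assms by (simp add: Inf_enat_def)
qed

lemma edn_attained:
  assumes "finite E"
  obtains F where "edge_dominating_set E F" "edge_domination_number E = enat (card F)"
proof -
  let ?S = "{enat (card F) |F. edge_dominating_set E F}"
  have "edge_dominating_set E E" by (simp add: edge_dominating_set_def)
  then have "?S \<noteq> {}" by blast
  then have "Inf ?S \<in> ?S" by (rule Inf_enat_attained)
  then show ?thesis using that unfolding edge_domination_number_def by blast
qed

lemma edn_le: "edge_dominating_set E F \<Longrightarrow> edge_domination_number E \<le> enat (card F)"
  unfolding edge_domination_number_def by (rule Inf_lower) blast

lemma tedn_le: "total_edge_dominating_set E K \<Longrightarrow> total_edge_domination_number E \<le> enat (card K)"
  unfolding total_edge_domination_number_def by (rule Inf_lower) blast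

text \<open>Given a sharp set \<open>F\<close>, choosing partners for any edge dominating set \<open>G\<close> yields
  \<open>2 |F| \<le> 2 |G|\<close>, so \<open>F\<close> is minimum; its own partners attain the value \<open>2 |F|\<close>.\<close>

lemma sharp_exists_iff:
  assumes fin: "finite E" and c2: "\<forall>e\<in>E. card e = 2"
  shows "total_edge_domination_number E = 2 * edge_domination_number E \<longleftrightarrow> (\<exists>F. sharp E F)"
proof
  assume eq: "total_edge_domination_number E = 2 * edge_domination_number E"
  obtain F where F: "edge_dominating_set E F" "edge_domination_number E = enat (card F)"
    using edn_attained[OF fin] .
  have tot: "total_edge_domination_number E = enat (2 * card F)"
    using eq F(2) by (simp add: numeral_eq_enat)
  then have "{enat (card K) |K. total_edge_dominating_set E K} \<noteq> {}"
    unfolding total_edge_domination_number_def by (auto simp: Inf_enat_def split: if_splits)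
  then obtain K where "total_edge_dominating_set E K" by blast
  then have "\<forall>e\<in>E. \<exists>e'\<in>E. adjacent_edges e e'"
    unfolding total_edge_dominating_set_def by blast
  moreover have "2 * card F \<le> card K" if "total_edge_dominating_set E K" for K
    using tedn_le[OF that] tot by simp
  ultimately have "sharp E F" using fin c2 F by (simp add: sharp_def)
  then show "\<exists>F. sharp E F" ..
next
  assume "\<exists>F. sharp E F"
  then obtain F where F: "sharp E F" ..
  then have ed: "edge_dominating_set E F" and adj: "\<forall>e\<in>E. \<exists>e'\<in>E. adjacent_edges e e'"
    and low: "\<And>K. total_edge_dominating_set E K \<Longrightarrow> 2 * card F \<le> card K"
    by (auto simp: sharp_def)
  have total: "\<exists>K. total_edge_dominating_set E K \<and> card K \<le> 2 * card G" if G: "edge_dominating_set E G" for G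
  proof -
    have "\<forall>f\<in>G. \<exists>e. e \<in> E \<and> adjacent_edges f e" using adj G unfolding edge_dominating_set_def by blast
    then obtain g where g: "\<And>f. f \<in> G \<Longrightarrow> g f \<in> E \<and> adjacent_edges f (g f)" by metis
    have "finite G" using G fin by (auto simp: edge_dominating_set_def intro: finite_subset)
    then have "card (G \<union> g ` G) \<le> 2 * card G"
      using card_Un_le[of G "g ` G"] card_image_le[of G g] by simp
    then show ?thesis using total_of_partners[OF G g] by blast
  qed
  obtain G where G: "edge_dominating_set E G" "edge_domination_number E = enat (card G)"
    using edn_attained[OF fin] .
  have "card F \<le> card G" using total[OF G(1)] low by fastforce
  then have edn: "edge_domination_number E = enat (card F)"
    using edn_le[OF ed] G(2) by (auto intro: antisym)
  obtain K where K: "total_edge_dominating_set E K" "card K \<le> 2 * card F" using total[OF ed] by blast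
  have "enat (2 * card F) \<le> total_edge_domination_number E"
    unfolding total_edge_domination_number_def using low by (intro Inf_greatest) auto
  moreover have "total_edge_domination_number E \<le> enat (2 * card F)"
    using tedn_le[OF K(1)] K(2) by (meson enat_ord_simps(1) order_trans)
  ultimately show "total_edge_domination_number E = 2 * edge_domination_number E"
    using edn by (simp add: numeral_eq_enat)
qed

section \<open>Members of the family are sharp\<close>

text \<open>The structure that both operations preserve: an \<open>L\<close> vertex has only \<open>C\<close> neighbours, and the edges
  between \<open>C\<close> vertices match the \<open>C\<close> vertices in pairs. The \<open>L\<close> neighbour of a \<open>C\<close> vertex gives every
  edge an adjacent one. The exclusion of triangles is what is needed of acyclicity:
  the mate of a neighbour of an \<open>L\<close> vertex is at distance two from that vertex.\<close>

definition spined :: "'a set \<Rightarrow> 'a set set \<Rightarrow> ('a \<Rightarrow> label) \<Rightarrow> bool" where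
  "spined V E l \<longleftrightarrow> finite V \<and>
     (\<forall>e\<in>E. e \<subseteq> V \<and> card e = 2) \<and>
     (\<forall>x y. {x, y} \<in> E \<longrightarrow> l x = L \<longrightarrow> l y = C) \<and>
     (\<forall>x\<in>V. l x = C \<longrightarrow> (\<exists>y. {x, y} \<in> E \<and> l y = L) \<and> (\<exists>!y. {x, y} \<in> E \<and> l y = C)) \<and>
     (\<forall>v u w. {v, u} \<in> E \<longrightarrow> {v, w} \<in> E \<longrightarrow> {u, w} \<in> E \<longrightarrow> l v \<noteq> L)"

definition spine :: "'a set set \<Rightarrow> ('a \<Rightarrow> label) \<Rightarrow> 'a set set" where
  "spine E l = {e \<in> E. \<forall>x\<in>e. l x = C}"

lemma spinedD:
  assumes "spined V E l"
  shows "finite V" "\<And>x y. {x, y} \<in> E \<Longrightarrow> x \<in> V \<and> y \<in> V \<and> x \<noteq> y" "finite E"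
    "\<And>e. e \<in> E \<Longrightarrow> e \<subseteq> V \<and> card e = 2"
    "\<And>x y. {x, y} \<in> E \<Longrightarrow> l x = L \<Longrightarrow> l y = C"
    "\<And>x. x \<in> V \<Longrightarrow> l x = C \<Longrightarrow> \<exists>y. {x, y} \<in> E \<and> l y = L"
    "\<And>x. x \<in> V \<Longrightarrow> l x = C \<Longrightarrow> \<exists>y. {x, y} \<in> E \<and> l y = C"
    "\<And>x y z. l x = C \<Longrightarrow> {x, y} \<in> E \<Longrightarrow> l y = C \<Longrightarrow> {x, z} \<in> E \<Longrightarrow> l z = C \<Longrightarrow> y = z"
    "\<And>v u w. {v, u} \<in> E \<Longrightarrow> {v, w} \<in> E \<Longrightarrow> {u, w} \<in> E \<Longrightarrow> l v \<noteq> L"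
proof -
  show fV: "finite V" and *: "\<And>e. e \<in> E \<Longrightarrow> e \<subseteq> V \<and> card e = 2"
    using assms by (simp_all add: spined_def)
  show e: "x \<in> V \<and> y \<in> V \<and> x \<noteq> y" if "{x, y} \<in> E" for x y
    using *[OF that] by (auto simp: card_2_iff doubleton_eq_iff)
  show "finite E" by (rule finite_subset[of _ "Pow V"]) (use * fV in auto)
  show "l y = C" if "{x, y} \<in> E" "l x = L" for x y using assms that unfolding spined_def by blast
  show "\<exists>y. {x, y} \<in> E \<and> l y = L" if "x \<in> V" "l x = C" for x
    using assms that unfolding spined_def by blast
  show "\<exists>y. {x, y} \<in> E \<and> l y = C" if "x \<in> V" "l x = C" for x
    using assms that unfolding spined_def by blast
  show "y = z" if "l x = C" "{x, y} \<in> E" "l y = C" "{x, z} \<in> E" "l z = C" for x y z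
    using assms that e[OF that(2)] unfolding spined_def by metis
  show "l v \<noteq> L" if "{v, u} \<in> E" "{v, w} \<in> E" "{u, w} \<in> E" for v u w
    using assms that unfolding spined_def by metis
qed

lemma label_cases: "l x = C \<or> l x = L"
  using label.exhaust by blast

text \<open>Each operation updates the labelling, but only at vertices that are new.\<close>

lemma spined_cong:
  assumes "spined V E l" "\<And>x. x \<in> V \<Longrightarrow> l' x = l x"
  shows "spined V E l'" "spine E l' = spine E l"
proof -
  note s = spinedD[OF assms(1)]
  have e: "l' x = l x \<and> l' y = l y" if "{x, y} \<in> E" for x y using s(2)[OF that] assms(2) by simp
  show "spined V E l'"
    unfolding spined_def
  proof (intro conjI allI ballI impI)
    show "finite V" by (rule s)
    show "e \<subseteq> V" "card e = 2" if "e \<in> E" for e using s(4)[OF that] by auto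
    show "l' y = C" if "{x, y} \<in> E" "l' x = L" for x y using s(5)[OF that(1)] e[OF that(1)] that by simp
    show "\<exists>y. {x, y} \<in> E \<and> l' y = L" if "x \<in> V" "l' x = C" for x
      using s(6)[OF that(1)] e assms(2) that by metis
    show "\<exists>!y. {x, y} \<in> E \<and> l' y = C" if "x \<in> V" "l' x = C" for x
      using s(7)[OF that(1)] s(8)[of x] e assms(2) that by metis
    show "l' v \<noteq> L" if "{v, u} \<in> E" "{v, w} \<in> E" "{u, w} \<in> E" for v u w
      using s(9)[OF that] e[OF that(1)] by simp
  qed
  have "(\<forall>x\<in>f. l' x = C) \<longleftrightarrow> (\<forall>x\<in>f. l x = C)" if "f \<in> E" for f
    using s(4)[OF that] assms(2) by (metis subsetD)
  then show "spine E l' = spine E l" unfolding spine_def by blast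
qed

lemma spined_add_leaf:
  assumes S: "spined V E l" and v: "v \<in> V" "l v = C" and u: "u \<notin> V" "l u = L"
  shows "spined (insert u V) (insert {v, u} E) l" "spine (insert {v, u} E) l = spine E l"
proof -
  note s = spinedD[OF S]
  have vu: "v \<noteq> u" using v u by auto
  have adj: "{x, y} \<in> insert {v, u} E \<longleftrightarrow> {x, y} \<in> E \<or> x = v \<and> y = u \<or> x = u \<and> y = v" for x y
    by (auto simp: doubleton_eq_iff)
  show "spined (insert u V) (insert {v, u} E) l"
    unfolding spined_def adj
  proof (intro conjI allI ballI impI)
    show "finite (insert u V)" using s by simp
    show "e \<subseteq> insert u V" "card e = 2" if "e \<in> insert {v, u} E" for e
      using that s(4)[of e] v vu by auto
    show "l y = C" if "{x, y} \<in> E \<or> x = v \<and> y = u \<or> x = u \<and> y = v" "l x = L" for x y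
      using that s(5)[of x y] v by auto
    show "\<exists>y. ({x, y} \<in> E \<or> x = v \<and> y = u \<or> x = u \<and> y = v) \<and> l y = L"
      if "x \<in> insert u V" "l x = C" for x
      using that s(6)[of x] u by auto
    show "\<exists>!y. ({x, y} \<in> E \<or> x = v \<and> y = u \<or> x = u \<and> y = v) \<and> l y = C"
      if "x \<in> insert u V" "l x = C" for x
      using that s(7,8)[of x] u by (metis insertE label.distinct(1))
    show "l p \<noteq> L"
      if "{p, q} \<in> E \<or> p = v \<and> q = u \<or> p = u \<and> q = v" "{p, w} \<in> E \<or> p = v \<and> w = u \<or> p = u \<and> w = v"
        "{q, w} \<in> E \<or> q = v \<and> w = u \<or> q = u \<and> w = v" for p q w
      using that s(9)[of p q w] s(2)[of p q] s(2)[of p w] s(2)[of q w] u v vu by metis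
  qed
  show "spine (insert {v, u} E) l = spine E l"
    using u by (auto simp: spine_def)
qed

lemma spined_add_path:
  assumes S: "spined V E l" and v: "v \<in> V" "l v = L"
    and new: "distinct [b, c, d]" "b \<notin> V" "c \<notin> V" "d \<notin> V" "l b = C" "l c = C" "l d = L"
  shows "spined (V \<union> {b, c, d}) (E \<union> {{v, b}, {b, c}, {c, d}}) l"
    "spine (E \<union> {{v, b}, {b, c}, {c, d}}) l = insert {b, c} (spine E l)"
proof -
  note s = spinedD[OF S]
  let ?E = "E \<union> {{v, b}, {b, c}, {c, d}}"
  define new where "new x y \<longleftrightarrow> x = v \<and> y = b \<or> x = b \<and> y = v \<or> x = b \<and> y = c \<or> x = c \<and> y = b \<or>
     x = c \<and> y = d \<or> x = d \<and> y = c" for x y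
  have adj: "{x, y} \<in> ?E \<longleftrightarrow> {x, y} \<in> E \<or> new x y" for x y
    unfolding new_def by (auto simp: doubleton_eq_iff)
  have ne: "v \<noteq> b" "v \<noteq> c" "v \<noteq> d" "b \<noteq> c" "b \<noteq> d" "c \<noteq> d" using assms by auto
  have newD: "x \<noteq> y \<and> (x \<notin> V \<or> y \<notin> V)" "x \<in> V \<Longrightarrow> x = v \<and> y = b" "new y x"
     "l x = L \<Longrightarrow> l y = C" if "new x y" for x y
    using that ne assms unfolding new_def by auto
  show "spined (V \<union> {b, c, d}) ?E l"
    unfolding spined_def adj
  proof (intro conjI allI ballI impI)
    show "finite (V \<union> {b, c, d})" using s by simp
    show "e \<subseteq> V \<union> {b, c, d}" "card e = 2" if "e \<in> ?E" for e
      using that s(4)[of e] v ne by auto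
    show "l y = C" if "{x, y} \<in> E \<or> new x y" "l x = L" for x y
      using that s(5)[of x y] newD by auto
    show "\<exists>y. ({x, y} \<in> E \<or> new x y) \<and> l y = L" if "x \<in> V \<union> {b, c, d}" "l x = C" for x
    proof -
      have "new b v" "new c d" by (auto simp: new_def)
      then show ?thesis using that s(6)[of x] v assms by auto
    qed
    show "\<exists>!y. ({x, y} \<in> E \<or> new x y) \<and> l y = C" if x: "x \<in> V \<union> {b, c, d}" "l x = C" for x
    proof -
      consider "x \<in> V" | "x = b" | "x = c" using x new by auto
      then show ?thesis
      proof cases
        case 1
        then have "\<not> new x y" for y using newD(2)[of x y] v x by auto
        then show ?thesis using s(7)[OF 1 x(2)] s(8)[OF x(2)] by blast
      next
        case 2
        have "new x y \<longleftrightarrow> y = v \<or> y = c" for y using 2 ne by (auto simp: new_def)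
        moreover have "{x, y} \<notin> E" for y using s(2)[of x y] 2 assms by auto
        ultimately show ?thesis using v assms by (intro ex1I[of _ c]) auto
      next
        case 3
        have "new x y \<longleftrightarrow> y = b \<or> y = d" for y using 3 ne by (auto simp: new_def)
        moreover have "{x, y} \<notin> E" for y using s(2)[of x y] 3 assms by auto
        ultimately show ?thesis using v assms by (intro ex1I[of _ b]) auto
      qed
    qed
    show "l p \<noteq> L"
      if h: "{p, q} \<in> E \<or> new p q" "{p, w} \<in> E \<or> new p w" "{q, w} \<in> E \<or> new q w" for p q w
    proof (cases "{p, q} \<in> E \<and> {p, w} \<in> E \<and> {q, w} \<in> E")
      case True then show ?thesis using s(9) by blast
    next
      case False
      have "\<not> (new p q \<and> new p w \<and> new q w)"
        using ne unfolding new_def by auto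
      then consider "new p q" "{p, w} \<in> E \<or> {q, w} \<in> E" | "new p w" "{p, q} \<in> E \<or> {q, w} \<in> E"
        | "new q w" "{p, q} \<in> E \<or> {p, w} \<in> E" using h False by blast
      then show ?thesis
        using s(2) h ne assms unfolding new_def by cases (metis, metis, metis)
    qed
  qed
  show "spine ?E l = insert {b, c} (spine E l)"
    using v new unfolding spine_def by auto
qed

lemma spined_two_neighbours:
  assumes "spined V E l" "x \<in> V" "l x = C"
  obtains z where "{x, z} \<in> E" "z \<noteq> y"
  using spinedD(6,7)[OF assms] by (metis label.distinct(1))

lemma family_spined: "labelled_family V E l \<Longrightarrow> spined V E l"
proof (induction rule: labelled_family.induct)
  case (P4 a b c d l)
  have adj: "{x, y} \<in> {{a, b}, {b, c}, {c, d}} \<longleftrightarrow> x = a \<and> y = b \<or> x = b \<and> y = a \<or> x = b \<and> y = c \<or>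
     x = c \<and> y = b \<or> x = c \<and> y = d \<or> x = d \<and> y = c" for x y
    by (auto simp: doubleton_eq_iff)
  have ne: "a \<noteq> b" "a \<noteq> c" "a \<noteq> d" "b \<noteq> c" "b \<noteq> d" "c \<noteq> d" using P4 by auto
  have "l a \<noteq> C" "l d \<noteq> C" using P4 by auto
  then show ?case
    unfolding spined_def adj using P4 ne by auto
next
  case (O1 V E l v b c d)
  let ?l = "l(b := C, c := C, d := L)"
  have "spined V E ?l" by (rule spined_cong[OF O1.IH]) (use O1.hyps in auto)
  then show ?case by (rule spined_add_path) (use O1.hyps in auto)
next
  case (O2 V E l v u)
  have "spined V E (l(u := L))" by (rule spined_cong[OF O2.IH]) (use O2.hyps in auto)
  then show ?case by (rule spined_add_leaf) (use O2.hyps in auto)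
qed

text \<open>Let the edge \<open>vu\<close> be undominated, with \<open>w\<close> the \<open>C\<close> neighbour of \<open>u\<close>. The first
  clause of the side condition gives \<open>w\<close> a leaf, so some
  edge of \<open>K\<close> other than \<open>uw\<close> meets \<open>w\<close>. If \<open>vu\<close> is in \<open>K\<close>, exchange it for \<open>uw\<close>. Otherwise no edge of
  \<open>K\<close> meets \<open>u\<close>; then \<open>u\<close> has no leaf other than \<open>v\<close>, since the edge to it would be undominated.
  So by the second clause all edges at \<open>w\<close> except \<open>uw\<close> lead to leaves, \<open>K\<close> contains two of them, and one can be exchanged for \<open>uw\<close>. Each exchange
  raises the number of spine edges in \<open>K\<close>, so the process stops.\<close>

lemma dominate_edges_at_vertex:
  assumes S: "spined V E l" and v: "v \<in> V" "l v = L" and O1: "O1_condition V E l v"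
  shows "K \<subseteq> E \<Longrightarrow> (\<And>e. e \<in> E \<Longrightarrow> v \<notin> e \<Longrightarrow> \<exists>f\<in>K. adjacent_edges e f) \<Longrightarrow>
    \<exists>K'. total_edge_dominating_set E K' \<and> card K' \<le> card K"
proof (induction "card (spine E l - K)" arbitrary: K rule: less_induct)
  case less
  note s = spinedD[OF S]
  note KE = less.prems(1) and dom = less.prems(2)
  have finK: "finite K" using KE s(3) by (rule finite_subset)
  have edgeE: "\<exists>z. e = {x, z} \<and> z \<noteq> x" if "e \<in> E" "x \<in> e" for e x
    using card2_other_end[of e x] s(4)[OF that(1)] that(2) by blast
  show ?case
  proof (cases "\<forall>e\<in>E. \<exists>f\<in>K. adjacent_edges e f")
    case True
    then show ?thesis using KE by (auto simp: total_edge_dominating_set_def)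
  next
    case False
    then obtain e where e: "e \<in> E" and nodom: "\<And>f. f \<in> K \<Longrightarrow> \<not> adjacent_edges e f" by blast
    then have "v \<in> e" using dom by blast
    then obtain u where eu: "e = {v, u}" using edgeE[OF e] by blast
    have vu: "{v, u} \<in> E" "u \<in> V" "u \<noteq> v" using e eu s(2)[of v u] by auto
    have lu: "l u = C" using s(5)[OF vu(1) v(2)] .
    obtain w where w: "{u, w} \<in> E" "l w = C" using s(7)[OF vu(2) lu] by blast
    have wV: "w \<in> V" "u \<noteq> w" "w \<noteq> v" using s(2)[OF w(1)] w v by auto
    have vw: "{v, w} \<notin> E" using s(9)[OF vu(1) _ w(1)] v by blast
    have uw_spine: "{u, w} \<in> spine E l" using w lu by (simp add: spine_def)
    have d2: "vdist V E v w = 2"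
    proof -
      have W: "walk V E [v, u, w]" using v vu w wV by (simp add: walk_def)
      then have le: "vdist V E v w \<le> 2" using vdist_le[of V E "[v, u, w]" v w 2] by simp
      obtain q where q: "walk V E q" "hd q = v" "last q = w" "length q = Suc (vdist V E v w)"
        using vdist_walk[OF W] by auto
      have "vdist V E v w \<noteq> 0" proof
        assume "vdist V E v w = 0"
        then obtain a where "q = [a]" using q(4) by (auto simp: length_Suc_conv)
        then show False using q(2,3) wV(3) by simp
      qed
      moreover have "vdist V E v w \<noteq> 1" proof
        assume "vdist V E v w = 1"
        then obtain a a' where "q = [a, a']" using q(4) by (auto simp: length_Suc_conv)
        then show False using q(1-3) vw by (simp add: walk_def)
      qed
      ultimately show ?thesis using le by simp
    qed
    have d1: "vdist V E v u = 1"
    proof -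
      have W: "walk V E [v, u]" using v vu by (simp add: walk_def)
      then have le: "vdist V E v u \<le> 1" using vdist_le[of V E "[v, u]" v u 1] by simp
      obtain q where q: "walk V E q" "hd q = v" "last q = u" "length q = Suc (vdist V E v u)"
        using vdist_walk[OF W] by auto
      have "vdist V E v u \<noteq> 0" proof
        assume "vdist V E v u = 0"
        then obtain a where "q = [a]" using q(4) by (auto simp: length_Suc_conv)
        then show False using q(2,3) vu(3) by simp
      qed
      then show ?thesis using le by simp
    qed
    have ed: "edge_dist V E v {w, u} = 1" using d1 d2 by (simp add: edge_dist_def)
    have wu: "{w, u} \<in> E" using w by (simp add: insert_commute)
    obtain y where y: "{w, y} \<in> E" "is_leaf E y"
      using O1 wV w(2) d2 unfolding O1_condition_def nbhd_def by blast
    have cond: "(\<exists>y\<in>nbhd E u. y \<noteq> v \<and> is_leaf E y) \<or> (\<forall>y\<in>nbhd E w - {u}. is_leaf E y)"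
      using O1 wV vu lu w(2) ed wu unfolding O1_condition_def by blast
    have leaf_dom: "\<exists>z. {q, z} \<in> K \<and> z \<noteq> y" if q: "{q, y} \<in> E" "is_leaf E y" "q \<noteq> v" "y \<noteq> v" for q y
    proof -
      obtain f where f: "f \<in> K" "adjacent_edges {q, y} f" using dom[OF q(1)] q by blast
      then have fE: "f \<in> E" using KE by blast
      then have "card f = 2" using s(4) by blast
      with f(2) show ?thesis
      proof (rule adjacent_pairE)
        fix z assume "f = {q, z}" "z \<noteq> y" then show ?thesis using f by blast
      next
        fix z assume z: "f = {y, z}" "z \<noteq> q" "z \<noteq> y"
        have "q = z" using leaf_neighbour_unique[OF q(2), of q z] q(1) z fE s(2)[OF q(1)]
          by (auto simp: insert_commute)
        then show ?thesis using z by blast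
      qed
    qed
    have "y \<noteq> v" using y vw by (auto simp: insert_commute)
    obtain z where z: "{w, z} \<in> K" "z \<noteq> y" using leaf_dom[OF y wV(3) \<open>y \<noteq> v\<close>] by blast
    have zE: "{w, z} \<in> E" using z KE by blast
    \<comment> \<open>The induction step common to both exchanges.\<close>
    have swap: ?thesis if x: "x \<in> K" "x \<notin> spine E l" and uwK: "{u, w} \<notin> K"
      and dom': "\<And>e. e \<in> E \<Longrightarrow> v \<notin> e \<Longrightarrow> \<exists>f\<in>insert {u, w} (K - {x}). adjacent_edges e f" for x
    proof -
      let ?K = "insert {u, w} (K - {x})"
      have "spine E l - ?K \<subset> spine E l - K" using x uwK uw_spine by blast
      moreover have "finite (spine E l - K)" using s(3) by (simp add: spine_def)
      ultimately have "card (spine E l - ?K) < card (spine E l - K)" by (rule psubset_card_mono[rotated])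
      moreover have "?K \<subseteq> E" using KE w by blast
      ultimately obtain K' where K': "total_edge_dominating_set E K'" "card K' \<le> card ?K"
        using less.hyps[of ?K] dom' by blast
      have "card ?K \<le> Suc (card (K - {x}))" by (rule card_insert_le_m1) auto
      also have "\<dots> = card K" by (rule card_Suc_Diff1[OF finK x(1)])
      finally show ?thesis using K' by (meson order_trans)
    qed
    have no_u: "u \<notin> f" if "f \<in> K" "f \<noteq> {v, u}" for f
      using nodom[OF that(1)] that(2) eu by (auto simp: adjacent_edges_def)
    have uwK: "{u, w} \<notin> K" using no_u[of "{u, w}"] wV vu by (auto simp: doubleton_eq_iff)
    have zu: "z \<noteq> u" using z uwK by (auto simp: insert_commute)
    show ?thesis
    proof (cases "{v, u} \<in> K")
      case True
      show ?thesis
      proof (rule swap[OF True _ uwK])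
        show "{v, u} \<notin> spine E l" using v by (simp add: spine_def)
        fix e' assume e': "e' \<in> E" "v \<notin> e'"
        obtain f where f: "f \<in> K" "adjacent_edges e' f" using dom[OF e'] by blast
        show "\<exists>f\<in>insert {u, w} (K - {{v, u}}). adjacent_edges e' f"
        proof (cases "f = {v, u}")
          case False then show ?thesis using f by blast
        next
          case True
          then have "u \<in> e'" using f e' by (auto simp: adjacent_edges_def)
          then obtain q where q: "e' = {u, q}" using edgeE[OF e'(1)] by blast
          show ?thesis
          proof (cases "q = w")
            case True
            have "adjacent_edges e' {w, z}"
              using q True adjacent_pairI[of u z w] zu by (simp add: insert_commute)
            moreover have "{w, z} \<noteq> {v, u}" using wV by (auto simp: doubleton_eq_iff)
            ultimately show ?thesis using z by blast
          next
            case False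
            then have "adjacent_edges e' {u, w}" using q adjacent_pairI by simp
            then show ?thesis by blast
          qed
        qed
      qed
    next
      case vuK: False
      have no_u': "u \<notin> f" if "f \<in> K" for f using no_u[OF that] that vuK by blast
      have all: "\<forall>y\<in>nbhd E w - {u}. is_leaf E y"
        using cond
      proof
        assume "\<exists>y\<in>nbhd E u. y \<noteq> v \<and> is_leaf E y"
        then obtain y where "{u, y} \<in> E" "is_leaf E y" "y \<noteq> v" by (auto simp: nbhd_def)
        then show ?thesis using leaf_dom[of u y] vu(3) no_u' by blast
      qed
      have zw: "z \<noteq> w" "z \<noteq> v" using s(2)[OF zE] zE vw by (auto simp: insert_commute)
      have zleaf: "is_leaf E z" using all zE zu zw by (simp add: nbhd_def)
      obtain z2 where z2: "{w, z2} \<in> K" "z2 \<noteq> z" using leaf_dom[OF zE zleaf wV(3) zw(2)] by blast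
      have z2u: "z2 \<noteq> u" using no_u'[OF z2(1)] by blast
      have "l z \<noteq> C" using s(8)[OF w(2) zE _ wu lu] zu by blast
      show ?thesis
      proof (rule swap[OF z(1) _ uwK])
        show "{w, z} \<notin> spine E l" using \<open>l z \<noteq> C\<close> by (simp add: spine_def)
        fix e' assume e': "e' \<in> E" "v \<notin> e'"
        obtain f where f: "f \<in> K" "adjacent_edges e' f" using dom[OF e'] by blast
        show "\<exists>f\<in>insert {u, w} (K - {{w, z}}). adjacent_edges e' f"
        proof (cases "f = {w, z}")
          case False then show ?thesis using f by blast
        next
          case True
          then have ne: "e' \<noteq> {w, z}" and "w \<in> e' \<or> z \<in> e'" using f by (auto simp: adjacent_edges_def)
          have "w \<in> e'"
          proof (rule ccontr)
            assume "w \<notin> e'"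
            then have "z \<in> e'" using \<open>w \<in> e' \<or> z \<in> e'\<close> by blast
            then obtain q where q: "e' = {z, q}" "q \<noteq> z" using edgeE[OF e'(1)] by blast
            then have "w = q" using leaf_neighbour_unique[OF zleaf, of w q] e' zE zw
              by (auto simp: insert_commute)
            then show False using q \<open>w \<notin> e'\<close> by blast
          qed
          then obtain q where q: "e' = {w, q}" using edgeE[OF e'(1)] by blast
          show ?thesis
          proof (cases "q = u")
            case True
            have "adjacent_edges e' {w, z2}" using q True adjacent_pairI[of u z2 w] z2u by simp
            moreover have "{w, z2} \<noteq> {w, z}" using z2 by (auto simp: doubleton_eq_iff)
            ultimately show ?thesis using z2 by blast
          next
            case False
            then have "adjacent_edges e' {u, w}"
              using q adjacent_pairI[of q u w] by (simp add: insert_commute)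
            then show ?thesis by blast
          qed
        qed
      qed
    qed
  qed
qed

text \<open>Only \<open>bc\<close> dominates \<open>cd\<close>, and \<open>bc\<close> itself needs a second edge of the path.\<close>

lemma pendant_path_needs_two:
  assumes K: "total_edge_dominating_set E' K" and E': "E' = E \<union> {{v, b}, {b, c}, {c, d}}"
    and new: "\<And>e. e \<in> E \<Longrightarrow> b \<notin> e \<and> c \<notin> e \<and> d \<notin> e" and dist: "distinct [v, b, c, d]" and fin: "finite E"
  shows "card (K \<inter> E) + 2 \<le> card K"
proof -
  have KE: "K \<subseteq> E'" using K by (simp add: total_edge_dominating_set_def)
  have ne: "v \<noteq> b" "v \<noteq> c" "v \<noteq> d" "b \<noteq> c" "b \<noteq> d" "c \<noteq> d" using dist by auto
  have "{c, d} \<in> E'" "{b, c} \<in> E'" using E' by auto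
  then obtain f g where f: "f \<in> K" "adjacent_edges {c, d} f" and g: "g \<in> K" "adjacent_edges {b, c} g"
    using K unfolding total_edge_dominating_set_def by blast
  have fE: "f \<in> E'" using f KE by blast
  have "f \<notin> E" using f new[of f] by (auto simp: adjacent_edges_def)
  moreover have "f \<noteq> {v, b}" "f \<noteq> {c, d}" using f ne by (auto simp: adjacent_edges_def)
  ultimately have "f = {b, c}" using fE E' by auto
  then have bc: "{b, c} \<in> K" using f by simp
  have "{b, c} \<notin> E" "g \<notin> E" "g \<noteq> {b, c}" using g new[of g] new[of "{b, c}"] by (auto simp: adjacent_edges_def)
  then have "card ((K \<inter> E) \<union> {{b, c}, g}) = card (K \<inter> E) + 2"
    using fin by (subst card_Un_disjoint) auto
  moreover have "card ((K \<inter> E) \<union> {{b, c}, g}) \<le> card K"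
  proof (rule card_mono)
    show "finite K" using KE E' fin by (auto intro: finite_subset)
  qed (use bc g in auto)
  ultimately show ?thesis by simp
qed

text \<open>For a new path the two preceding lemmas give the step. For a new leaf \<open>u\<close> at \<open>v\<close>: if a total edge dominating set uses \<open>vu\<close>, it contains another edge \<open>vx\<close>,
  and since \<open>v\<close> had two neighbours before, \<open>vu\<close> can be exchanged for an old edge \<open>vz\<close> with
  \<open>z \<noteq> x\<close>.\<close>

lemma family_lower_bound:
  "labelled_family V E l \<Longrightarrow> total_edge_dominating_set E K \<Longrightarrow> 2 * card (spine E l) \<le> card K"
proof (induction arbitrary: K rule: labelled_family.induct)
  case (P4 a b c d l)
  have "card (K \<inter> {}) + 2 \<le> card K"
    by (rule pendant_path_needs_two[OF P4.prems, where v = a and b = b and c = c and d = d])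
      (use P4.hyps in auto)
  moreover have "spine {{a, b}, {b, c}, {c, d}} l = {{b, c}}"
    using P4.hyps by (auto simp: spine_def)
  ultimately show ?case by simp
next
  case (O1 V E l v b c d)
  let ?l = "l(b := C, c := C, d := L)"
  let ?E = "E \<union> {{v, b}, {b, c}, {c, d}}"
  have S: "spined V E l" by (rule family_spined[OF O1.hyps(1)])
  note s = spinedD[OF S]
  have out: "b \<notin> V" "c \<notin> V" "d \<notin> V" "distinct [b, c, d]" using O1.hyps by auto
  have S': "spined V E ?l" "spine E ?l = spine E l"
    by (rule spined_cong[OF S]; use out in auto)+
  have sp: "spine ?E ?l = insert {b, c} (spine E l)"
    unfolding S'(2)[symmetric]
    by (rule spined_add_path(2)[OF S'(1)]) (use O1.hyps(2,3) out in auto)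
  have "finite (spine E l)" using s(3) by (simp add: spine_def)
  then have csp: "card (spine ?E ?l) \<le> Suc (card (spine E l))"
    unfolding sp by (simp add: card_insert_if)
  have new: "b \<notin> e \<and> c \<notin> e \<and> d \<notin> e" if "e \<in> E" for e using s(4)[OF that] out by blast
  have vne: "v \<noteq> b" "v \<noteq> c" "v \<noteq> d" using out O1.hyps(2) by auto
  have two: "card (K \<inter> E) + 2 \<le> card K"
  proof (rule pendant_path_needs_two[OF O1.prems refl new])
    show "distinct [v, b, c, d]" using out O1.hyps(2) by auto
  qed (use s in auto)
  obtain K' where K': "total_edge_dominating_set E K'" "card K' \<le> card (K \<inter> E)"
  proof -
    have "\<exists>f\<in>K \<inter> E. adjacent_edges e f" if e: "e \<in> E" "v \<notin> e" for e
    proof -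
      obtain f where f: "f \<in> K" "adjacent_edges e f"
        using O1.prems e unfolding total_edge_dominating_set_def by blast
      have "f \<in> ?E" using f O1.prems unfolding total_edge_dominating_set_def by blast
      moreover have "f \<notin> {{v, b}, {b, c}, {c, d}}"
        using f(2) e(2) new[OF e(1)] by (auto simp: adjacent_edges_def)
      ultimately show ?thesis using f by blast
    qed
    then show thesis
      using dominate_edges_at_vertex[OF S O1.hyps(2,3,4), of "K \<inter> E"] that by blast
  qed
  have "2 * card (spine E l) \<le> card K'" by (rule O1.IH[OF K'(1)])
  then show ?case using csp K'(2) two by linarith
next
  case (O2 V E l v u)
  let ?l = "l(u := L)"
  have S: "spined V E l" by (rule family_spined[OF O2.hyps(1)])
  note s = spinedD[OF S]
  have S': "spined V E ?l" "spine E ?l = spine E l"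
    by (rule spined_cong[OF S]; use O2.hyps in auto)+
  have vu: "v \<noteq> u" using O2.hyps by auto
  have sp: "spine (insert {v, u} E) ?l = spine E l"
    unfolding S'(2)[symmetric]
    by (rule spined_add_leaf(2)[OF S'(1)]) (use O2.hyps(2-4) vu in auto)
  have KE: "K \<subseteq> insert {v, u} E" and dom: "\<And>e. e \<in> insert {v, u} E \<Longrightarrow> \<exists>f\<in>K. adjacent_edges e f"
    using O2.prems by (auto simp: total_edge_dominating_set_def)
  have noE: "u \<notin> e" if "e \<in> E" for e using s(4)[OF that] O2.hyps by blast
  have finK: "finite K" using KE s(3) by (auto intro: finite_subset)
  obtain K' where K': "total_edge_dominating_set E K'" "card K' \<le> card K"
  proof (cases "{v, u} \<in> K")
    case False
    then have "total_edge_dominating_set E K" using KE dom by (auto simp: total_edge_dominating_set_def)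
    then show ?thesis using that by blast
  next
    case True
    obtain f where f: "f \<in> K" "adjacent_edges {v, u} f" using dom by blast
    then have "f \<noteq> {v, u}" by (auto simp: adjacent_edges_def)
    then have fE: "f \<in> E" using f KE by blast
    then have "v \<in> f" using f(2) noE by (auto simp: adjacent_edges_def)
    then obtain x where x: "f = {v, x}" "x \<noteq> v"
      using card2_other_end[of f v] s(4)[OF fE] by blast
    obtain z where z: "{v, z} \<in> E" "z \<noteq> x"
      using spined_two_neighbours[OF S O2.hyps(2,3)] by blast
    let ?K = "insert {v, z} (K - {{v, u}})"
    have "total_edge_dominating_set E ?K"
      unfolding total_edge_dominating_set_def
    proof (intro conjI ballI)
      show "?K \<subseteq> E" using KE z by blast
      fix e assume e: "e \<in> E"
      obtain g where g: "g \<in> K" "adjacent_edges e g" using dom e by blast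
      show "\<exists>f\<in>?K. adjacent_edges e f"
      proof (cases "g = {v, u}")
        case False then show ?thesis using g by blast
      next
        case True
        then have "v \<in> e" using g noE[OF e] by (auto simp: adjacent_edges_def)
        then obtain q where q: "e = {v, q}" using card2_other_end[of e v] s(4)[OF e] by blast
        show ?thesis
        proof (cases "q = x")
          case True
          then have "adjacent_edges e {v, z}" using q z(2) adjacent_pairI[of x z v] by simp
          then show ?thesis by blast
        next
          case False
          then have "adjacent_edges e f" using q x adjacent_pairI by simp
          then show ?thesis using f \<open>f \<noteq> {v, u}\<close> by blast
        qed
      qed
    qed
    moreover have "card ?K \<le> card K"
    proof -
      have "card ?K \<le> Suc (card (K - {{v, u}}))" by (rule card_insert_le_m1) auto
      also have "\<dots> = card K" using finK True by (rule card_Suc_Diff1)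
      finally show ?thesis .
    qed
    ultimately show ?thesis using that by blast
  qed
  have "2 * card (spine E l) \<le> card K'" by (rule O2.IH[OF K'(1)])
  then show ?case unfolding sp using K'(2) by linarith
qed

lemma family_sharp:
  assumes fam: "labelled_family V E l"
  shows "sharp E (spine E l)"
proof -
  have S: "spined V E l" by (rule family_spined[OF fam])
  note s = spinedD[OF S]
  have central: "\<exists>x y. e = {x, y} \<and> x \<in> V \<and> l x = C" if e: "e \<in> E" for e
  proof -
    obtain x y where xy: "e = {x, y}" using s(4)[OF e] by (auto simp: card_2_iff)
    then have "l x = C \<or> l y = C" using s(5)[of x y] e label_cases[of l x] by auto
    then show ?thesis using xy s(2)[of x y] e by (metis insert_commute)
  qed
  have "\<exists>f\<in>spine E l. adjacent_edges e f" if e: "e \<in> E - spine E l" for e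
  proof -
    obtain x y where xy: "e = {x, y}" "x \<in> V" "l x = C" using central e by blast
    obtain z where z: "{x, z} \<in> E" "l z = C" using s(7)[OF xy(2,3)] by blast
    then have "{x, z} \<in> spine E l" using xy by (simp add: spine_def)
    moreover from this have "adjacent_edges e {x, z}" using xy e by (auto simp: adjacent_edges_def)
    ultimately show ?thesis by blast
  qed
  then have "edge_dominating_set E (spine E l)" by (auto simp: edge_dominating_set_def spine_def)
  moreover have "\<exists>e'\<in>E. adjacent_edges e e'" if e: "e \<in> E" for e
  proof -
    obtain x y where xy: "e = {x, y}" "x \<in> V" "l x = C" using central e by blast
    obtain z where z: "{x, z} \<in> E" "z \<noteq> y" using spined_two_neighbours[OF S xy(2,3)] by blast
    then have "adjacent_edges e {x, z}" using xy adjacent_pairI[of y z x] by simp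
    then show ?thesis using z by blast
  qed
  ultimately show ?thesis
    using s(3,4) family_lower_bound[OF fam] by (auto simp: sharp_def)
qed

section \<open>Levels of a rooted tree\<close>

text \<open>What acyclicity and connectedness give for the distance \<open>d\<close> from a root \<open>v\<close>: edges join consecutive
  levels, and every vertex other than the root has exactly one neighbour nearer to the root, its parent.\<close>

definition levels :: "'a set \<Rightarrow> 'a set set \<Rightarrow> 'a \<Rightarrow> ('a \<Rightarrow> nat) \<Rightarrow> bool" where
  "levels V E v d \<longleftrightarrow> d v = 0 \<and> (\<forall>x\<in>V. d x = 0 \<longrightarrow> x = v) \<and>
     (\<forall>x y. {x, y} \<in> E \<longrightarrow> d y = Suc (d x) \<or> d x = Suc (d y)) \<and>
     (\<forall>x y z. {x, y} \<in> E \<longrightarrow> {x, z} \<in> E \<longrightarrow> d y < d x \<longrightarrow> d z < d x \<longrightarrow> y = z) \<and>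
     (\<forall>x\<in>V. x \<noteq> v \<longrightarrow> (\<exists>y. {x, y} \<in> E \<and> d y < d x))"

text \<open>Follow shortest ways from both vertices back to the root until they meet.\<close>

lemma path_below_level:
  fixes d :: "'a \<Rightarrow> nat"
  assumes root: "\<And>x. x \<in> V \<Longrightarrow> d x = 0 \<Longrightarrow> x = v"
    and down: "\<And>x. x \<in> V \<Longrightarrow> x \<noteq> v \<Longrightarrow> \<exists>y\<in>V. {x, y} \<in> E \<and> d x = Suc (d y)"
    and dv: "d v = 0"
  shows "x \<in> V \<Longrightarrow> y \<in> V \<Longrightarrow> x \<noteq> y \<Longrightarrow> d x = n \<Longrightarrow> d y = n \<Longrightarrow>
    \<exists>p. walk V E p \<and> distinct p \<and> hd p = x \<and> last p = y \<and> length p \<ge> 3 \<and> (\<forall>z\<in>set p. d z \<le> n)"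
proof (induction n arbitrary: x y)
  case 0
  then show ?case using root by metis
next
  case (Suc n)
  have "x \<noteq> v" "y \<noteq> v" using Suc.prems dv by auto
  then obtain x' y' where x': "x' \<in> V" "{x, x'} \<in> E" "d x' = n"
    and y': "y' \<in> V" "{y, y'} \<in> E" "d y' = n"
    using down[of x] down[of y] Suc.prems by auto
  show ?case
  proof (cases "x' = y'")
    case True
    have "walk V E [x, x', y]"
      using x' y' True Suc.prems by (auto simp: walk_def insert_commute)
    moreover have "distinct [x, x', y]" using Suc.prems x' by auto
    ultimately show ?thesis using Suc.prems x'(3) by (intro exI[of _ "[x, x', y]"]) auto
  next
    case False
    from Suc.IH[OF x'(1) y'(1) False x'(3) y'(3)] obtain p where
      p: "walk V E p" "distinct p" "hd p = x'" "last p = y'" "\<forall>z\<in>set p. d z \<le> n" "length p \<ge> 3"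
      by blast
    have "p \<noteq> []" using p(6) by auto
    have out: "x \<notin> set p" "y \<notin> set p" using p(5) Suc.prems by fastforce+
    have "walk V E (x # p @ [y])"
      using p x' y' Suc.prems \<open>p \<noteq> []\<close> by (auto simp: walk_Cons walk_snoc insert_commute)
    moreover have "distinct (x # p @ [y])" using p(2) out Suc.prems by auto
    ultimately show ?thesis
      using p Suc.prems by (intro exI[of _ "x # p @ [y]"]) (auto intro: le_SucI)
  qed
qed

text \<open>An edge inside one level, or two parents of one vertex, would close a cycle with a path as in
  \<open>path_below_level\<close>.\<close>

lemma tree_levels:
  assumes t: "tree V E" and v: "v \<in> V"
  obtains d where "levels V E v d"
proof -
  define d where "d = vdist V E v"
  have sg: "simple_graph V E" and cg: "connected_graph V E" and ac: "\<And>p. \<not> cycle V E p"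
    using t by (auto simp: tree_def)
  have inV: "x \<in> V" "y \<in> V" "x \<noteq> y" if "{x, y} \<in> E" for x y
    using sg that by (force simp: simple_graph_def card_2_iff doubleton_eq_iff)+
  have shortest: "\<exists>p. walk V E p \<and> hd p = v \<and> last p = x \<and> length p = Suc (d x)" if "x \<in> V" for x
    using cg v that vdist_walk unfolding connected_graph_def d_def by metis
  have dv: "d v = 0" using vdist_le[of V E "[v]" v v 0] v by (simp add: d_def walk_def)
  have root: "x = v" if x: "x \<in> V" "d x = 0" for x
    using shortest[OF x(1)] x(2) by (auto simp: length_Suc_conv)
  have step: "d y \<le> Suc (d x)" if e: "{x, y} \<in> E" for x y
  proof -
    from shortest[OF inV(1)[OF e]] obtain p where
      p: "walk V E p" "hd p = v" "last p = x" "length p = Suc (d x)" by blast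
    then have "p \<noteq> []" by auto
    then have "walk V E (p @ [y])" "hd (p @ [y]) = v" using p e inV(2)[OF e] by (auto simp: walk_snoc)
    then show ?thesis using vdist_le[of V E "p @ [y]" v y "Suc (d x)"] p(4) by (simp add: d_def)
  qed
  have down: "\<exists>y\<in>V. {x, y} \<in> E \<and> d x = Suc (d y)" if x: "x \<in> V" "x \<noteq> v" for x
  proof -
    from shortest[OF x(1)] obtain p where
      p: "walk V E p" "hd p = v" "last p = x" "length p = Suc (d x)" by blast
    then obtain q where q: "p = q @ [x]" by (metis append_butlast_last_id length_0_conv nat.distinct(1))
    with p x have "q \<noteq> []" by auto
    moreover have "length q = d x" using p q by simp
    ultimately have "d x > 0" by (metis length_0_conv neq0_conv)
    with p q \<open>q \<noteq> []\<close> have w: "walk V E q" "hd q = v" "{last q, x} \<in> E" "length q \<le> Suc (d x - 1)" "d x > 0"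
      by (auto simp: walk_snoc)
    have "d (last q) \<le> d x - 1" using vdist_le[OF w(1,2) refl w(4)] by (simp add: d_def)
    with step[OF w(3)] w(5) have "d x = Suc (d (last q))" by simp
    then show ?thesis using w(3) inV by (metis insert_commute)
  qed
  have path: "\<exists>p. walk V E p \<and> distinct p \<and> hd p = x \<and> last p = y \<and> length p \<ge> 3
      \<and> (\<forall>z\<in>set p. d z \<le> n)"
    if "x \<in> V" "y \<in> V" "x \<noteq> y" "d x = n" "d y = n" for x y n
    by (rule path_below_level[where v = v]) (use root down dv that in blast)+
  have flat: "d x \<noteq> d y" if e: "{x, y} \<in> E" for x y
  proof
    assume "d x = d y"
    from path[OF inV[OF e] this refl]
    obtain p where "walk V E p" "distinct p" "hd p = x" "last p = y" "length p \<ge> 3"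
      by blast
    then have "cycle V E p" using e by (simp add: cycle_def insert_commute)
    then show False using ac by blast
  qed
  have edge: "d y = Suc (d x) \<or> d x = Suc (d y)" if e: "{x, y} \<in> E" for x y
    using step[OF e] step[of y x] flat[OF e] e by (auto simp: insert_commute)
  have uniq: "y = z" if e: "{x, y} \<in> E" "{x, z} \<in> E" "d y < d x" "d z < d x" for x y z
  proof (rule ccontr)
    assume "y \<noteq> z"
    have dd: "d x = Suc (d y)" "d z = d y" using edge[OF e(1)] edge[OF e(2)] e(3,4) by auto
    from path[OF inV(2)[OF e(1)] inV(2)[OF e(2)] \<open>y \<noteq> z\<close> refl dd(2)]
    obtain p where p: "walk V E p" "distinct p" "hd p = y" "last p = z" "length p \<ge> 3"
      "\<forall>u\<in>set p. d u \<le> d y" by blast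
    have "x \<notin> set p" using p(6) dd(1) by fastforce
    then have "cycle V E (x # p)"
      using p e inV[OF e(1)] by (auto simp: cycle_def walk_Cons insert_commute)
    then show False using ac by blast
  qed
  have "levels V E v d"
    unfolding levels_def
  proof (intro conjI allI impI ballI)
    show "\<exists>y. {x, y} \<in> E \<and> d y < d x" if "x \<in> V" "x \<noteq> v" for x
      using down[OF that] by auto
  qed (use dv root edge uniq in blast)+
  then show thesis by (rule that)
qed

lemma closed_under_edges:
  assumes "connected_graph V E" "x \<in> S" "x \<in> V" "\<And>y z. y \<in> S \<Longrightarrow> {y, z} \<in> E \<Longrightarrow> z \<in> S"
  shows "V \<subseteq> S"
proof
  fix y assume "y \<in> V"
  then obtain p where p: "walk V E p" "hd p = x" "last p = y"
    using assms(1,3) unfolding connected_graph_def by meson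
  have "walk V E p \<Longrightarrow> hd p \<in> S \<Longrightarrow> set p \<subseteq> S" for p
    by (induction p) (auto simp: walk_Cons assms(4))
  with p have "set p \<subseteq> S" using assms(2) by blast
  moreover have "y \<in> set p" using p by (auto simp: walk_def)
  ultimately show "y \<in> S" by blast
qed

section \<open>Sharp edge dominating sets are induced matchings\<close>

text \<open>Two edges of \<open>F\<close> must not be able to share a partner.\<close>

lemma sharp_one_neighbour:
  assumes s: "sharp E F" and "f \<in> F" "f' \<in> F" "e \<in> E" "adjacent_edges f e" "adjacent_edges f' e"
  shows "f = f'"
proof -
  from sharp_partner_fun[OF s] obtain g where g: "\<And>f. f \<in> F \<Longrightarrow> g f \<in> E \<and> adjacent_edges f (g f)"
    by blast
  have "inj_on (g(f := e, f' := e)) F" by (rule sharp_partners(1)[OF s]) (use g assms in auto)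
  then show ?thesis using assms by (auto simp: inj_on_def split: if_splits)
qed

text \<open>Two adjacent edges of \<open>F\<close> could serve as partners, but partners lie outside \<open>F\<close>.\<close>

lemma sharp_matching:
  assumes s: "sharp E F" and "f \<in> F" "f' \<in> F" "f \<inter> f' \<noteq> {}"
  shows "f = f'"
proof (rule ccontr)
  assume ne: "f \<noteq> f'"
  from sharp_partner_fun[OF s] obtain g where g: "\<And>f. f \<in> F \<Longrightarrow> g f \<in> E \<and> adjacent_edges f (g f)"
    by blast
  have "f' \<in> E" using s assms by (auto simp: sharp_def edge_dominating_set_def)
  have "(g(f := f')) ` F \<inter> F = {}"
    by (rule sharp_partners(2)[OF s]) (use g assms ne \<open>f' \<in> E\<close> in \<open>auto simp: adjacent_edges_def\<close>)
  then show False using assms by auto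
qed

text \<open>An edge outside \<open>F\<close> that joins two edges of \<open>F\<close> is adjacent to both.\<close>

lemma sharp_induced:
  assumes s: "sharp E F" and e: "e \<in> E" "e \<subseteq> \<Union>F"
  shows "e \<in> F"
proof (rule ccontr)
  assume n: "e \<notin> F"
  have c: "\<And>f. f \<in> E \<Longrightarrow> card f = 2" and sub: "F \<subseteq> E"
    using s by (auto simp: sharp_def edge_dominating_set_def)
  obtain x y where xy: "e = {x, y}" "x \<noteq> y" using c[OF e(1)] by (auto simp: card_2_iff)
  then obtain f f' where f: "f \<in> F" "x \<in> f" "f' \<in> F" "y \<in> f'" using e by auto
  have a: "adjacent_edges f e" "adjacent_edges f' e"
    using f n xy by (auto simp: adjacent_edges_def)
  have "f = f'" using sharp_one_neighbour[OF s f(1,3) e(1) a] .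
  then have "e \<subseteq> f" using f xy by auto
  moreover have "card f = 2" using c f(1) sub by auto
  ultimately have "e = f" using c[OF e(1)] card_subset_eq[of f e] card.infinite[of f] by auto
  then show False using f n by simp
qed

lemma sharp_meets:
  assumes "sharp E F" "e \<in> E" shows "e \<inter> \<Union>F \<noteq> {}"
proof -
  have c: "card e = 2" and F: "edge_dominating_set E F" using assms by (auto simp: sharp_def)
  show ?thesis
  proof (cases "e \<in> F")
    case True
    moreover have "e \<noteq> {}" using c by auto
    ultimately show ?thesis by auto
  next
    case False
    then obtain f where "f \<in> F" "adjacent_edges e f"
      using F assms(2) by (auto simp: edge_dominating_set_def)
    then show ?thesis by (auto simp: adjacent_edges_def)
  qed
qed

section \<open>Sharp edge dominating sets of trees\<close>

locale sharp_tree =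
  fixes V :: "'a set" and E F :: "'a set set"
  assumes tree: "tree V E" and big: "card V \<ge> 2" and not_star: "\<not> star V E" and sharp: "sharp E F"
begin

lemma edge_ends: "{x, y} \<in> E \<Longrightarrow> x \<noteq> y \<and> x \<in> V \<and> y \<in> V"
  using tree unfolding tree_def simple_graph_def by (metis card_2_iff doubleton_eq_iff insert_subset)

lemma finite_V: "finite V" and conn: "connected_graph V E"
  using tree by (simp_all add: tree_def simple_graph_def)

lemma card_edge: "e \<in> E \<Longrightarrow> card e = 2"
  using sharp by (simp add: sharp_def)

lemma F_sub: "F \<subseteq> E" and finite_F: "finite F"
  using sharp by (auto simp: sharp_def edge_dominating_set_def intro: finite_subset)

lemma dominated: "e \<in> E \<Longrightarrow> e \<notin> F \<Longrightarrow> \<exists>f\<in>F. adjacent_edges e f"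
  using sharp by (simp add: sharp_def edge_dominating_set_def)

lemma finite_nbhd: "finite (nbhd E x)"
  by (rule finite_subset[OF _ finite_V]) (auto simp: nbhd_def edge_ends)

lemma nbhd_iff: "y \<in> nbhd E x \<longleftrightarrow> {x, y} \<in> E"
  using edge_ends by (auto simp: nbhd_def)

lemma mate_unique: "{x, y} \<in> F \<Longrightarrow> {x, z} \<in> F \<Longrightarrow> y = z"
  using sharp_matching[OF sharp, of "{x, y}" "{x, z}"] by (auto simp: doubleton_eq_iff)

lemma mate:
  assumes "x \<in> f" "f \<in> F"
  obtains y where "f = {x, y}" "y \<noteq> x"
  using assms card_edge F_sub card2_other_end by (metis subsetD)

lemma inner_edge: "{x, y} \<in> E \<Longrightarrow> x \<in> \<Union>F \<Longrightarrow> y \<in> \<Union>F \<Longrightarrow> {x, y} \<in> F"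
  using sharp_induced[OF sharp, of "{x, y}"] by simp

lemma meets: "{x, y} \<in> E \<Longrightarrow> x \<notin> \<Union>F \<Longrightarrow> y \<in> \<Union>F"
  using sharp_meets[OF sharp, of "{x, y}"] by auto

text \<open>Suppose \<open>w\<close> has only its mate \<open>u\<close> as neighbour. Exchanging \<open>wu\<close> for any other edge \<open>ux\<close> keeps the
  set sharp, and if \<open>x\<close> had another neighbour, the edge to it would be adjacent to two edges of the
  new sharp set. So all neighbours of \<open>u\<close> are leaves and the tree is a star.\<close>

lemma outer_neighbour:
  assumes w: "w \<in> \<Union>F"
  obtains x where "{w, x} \<in> E" "x \<notin> \<Union>F"
proof (rule ccontr)
  assume "\<not> thesis"
  with that have allC: "\<And>x. {w, x} \<in> E \<Longrightarrow> x \<in> \<Union>F" by blast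
  from w obtain f where f: "f \<in> F" "w \<in> f" by blast
  then obtain u where u: "f = {w, u}" "u \<noteq> w" using mate by metis
  have wuF: "{w, u} \<in> F" and wuE: "{w, u} \<in> E" using f u F_sub by auto
  have only: "x = u" if "{w, x} \<in> E" for x
    using mate_unique[OF inner_edge[OF that w allC[OF that]] wuF] .
  have leafw: "is_leaf E w"
  proof -
    have "nbhd E w = {u}" using only wuE nbhd_iff by blast
    then show ?thesis by (simp add: is_leaf_def)
  qed
  have leaf: "is_leaf E x" if x: "{u, x} \<in> E" for x
  proof (rule ccontr)
    assume nl: "\<not> is_leaf E x"
    then have "x \<noteq> w" using leafw by auto
    have "x \<notin> \<Union>F"
      using inner_edge[OF x] wuF mate_unique[of u x w] \<open>x \<noteq> w\<close> by (auto simp: insert_commute)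
    obtain y where y: "{x, y} \<in> E" "y \<noteq> x" "y \<noteq> u"
      using nl x edge_ends[OF x] not_leaf_other_neighbour[of E x u] by (metis insert_commute)
    have "y \<in> \<Union>F" using meets[OF y(1) \<open>x \<notin> \<Union>F\<close>] .
    then obtain f' where f': "f' \<in> F" "y \<in> f'" by blast
    have "y \<noteq> w" using only[of x] y edge_ends[OF x] by (auto simp: insert_commute)
    then have f'ne: "f' \<noteq> {w, u}" using f' y by auto
    \<comment> \<open>The sharp set after the exchange of \<open>wu\<close> for \<open>ux\<close>.\<close>
    define F' where "F' = insert {u, x} (F - {{w, u}})"
    have "{u, x} \<notin> F" using \<open>x \<notin> \<Union>F\<close> by auto
    then have cF: "card F' = card F"
      using card_Suc_Diff1[OF finite_F wuF] finite_F by (simp add: F'_def)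
    have "edge_dominating_set E F'"
      unfolding edge_dominating_set_def
    proof (intro conjI ballI)
      show "F' \<subseteq> E" using F_sub x by (auto simp: F'_def)
      fix e assume e: "e \<in> E - F'"
      show "\<exists>f\<in>F'. adjacent_edges e f"
      proof (cases "u \<in> e")
        case True
        then obtain z where z: "e = {u, z}" using e card2_other_end card_edge by (metis Diff_iff)
        then have "z \<noteq> x" using e by (auto simp: F'_def)
        then have "adjacent_edges e {u, x}" unfolding z by (rule adjacent_pairI)
        then show ?thesis by (auto simp: F'_def)
      next
        case False
        have "w \<notin> e"
        proof
          assume "w \<in> e"
          then obtain z where z: "e = {w, z}" using e card2_other_end[OF card_edge] by blast
          then show False using only[of z] e False by blast
        qed
        with False e have "e \<in> E" "e \<notin> F" by (auto simp: F'_def)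
        then obtain g where g: "g \<in> F" "adjacent_edges e g"
          using dominated by blast
        then have "g \<noteq> {w, u}" using False \<open>w \<notin> e\<close> by (auto simp: adjacent_edges_def)
        then show ?thesis using g by (auto simp: F'_def)
      qed
    qed
    then have sh: "sharp E F'" using sharp cF by (simp add: sharp_def)
    have "{u, x} = f'"
    proof (rule sharp_one_neighbour[OF sh _ _ y(1)])
      show "{u, x} \<in> F'" "f' \<in> F'" using f' f'ne by (auto simp: F'_def)
      show "adjacent_edges {u, x} {x, y}" using y adjacent_pairI[of u y x] by (simp add: insert_commute)
      show "adjacent_edges f' {x, y}" using f' \<open>x \<notin> \<Union>F\<close> by (auto simp: adjacent_edges_def)
    qed
    then show False using f' \<open>x \<notin> \<Union>F\<close> by auto
  qed
  have uV: "u \<in> V" "w \<in> V" using edge_ends[OF wuE] by auto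
  have "V \<subseteq> insert u (nbhd E u)"
  proof (rule closed_under_edges[OF conn _ uV(1)])
    fix y z assume y: "y \<in> insert u (nbhd E u)" and yz: "{y, z} \<in> E"
    show "z \<in> insert u (nbhd E u)"
    proof (cases "y = u")
      case True then show ?thesis using yz by (simp add: nbhd_iff)
    next
      case False
      then have "{u, y} \<in> E" using y by (simp add: nbhd_iff)
      then have "u = z" using leaf_neighbour_unique[OF leaf, of y u z] yz False edge_ends[OF yz]
        by (auto simp: insert_commute)
      then show ?thesis by simp
    qed
  qed simp
  then have leaves: "is_leaf E z" if "z \<in> V" "z \<noteq> u" for z
    using that leaf by (auto simp: nbhd_iff)
  have nlu: "\<not> is_leaf E u"
  proof
    assume lu: "is_leaf E u"
    obtain e where e: "e \<in> E" "adjacent_edges {w, u} e" using sharp wuE by (auto simp: sharp_def)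
    from e(2) card_edge[OF e(1)] show False
    proof (rule adjacent_pairE)
      fix z assume "e = {w, z}" "z \<noteq> u" "z \<noteq> w" then show False using only[of z] e by blast
    next
      fix z assume "e = {u, z}" "z \<noteq> w" "z \<noteq> u"
      then show False using leaf_neighbour_unique[OF lu, of w z] e wuE u by (auto simp: insert_commute)
    qed
  qed
  have "star V E"
    unfolding star_def
  proof (intro conjI tree)
    show "\<exists>!c. c \<in> V \<and> \<not> is_leaf E c" using nlu leaves uV by blast
    have "card {v \<in> V. is_leaf E v} > 0" using leafw uV finite_V by (auto simp: card_gt_0_iff)
    then show "\<exists>k>0. card {v \<in> V. is_leaf E v} = k" by blast
  qed
  then show False using not_star by blast
qed

text \<open>In a tree rooted at a vertex \<open>v\<close> outside \<open>\<Union>F\<close>, every \<open>f \<in> F\<close> can take as its partner the edge from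
  its end nearer to the root to the parent of that end. Then every outer
  vertex is joined to each of its children by such a partner.\<close>

lemma entry_edges:
  assumes lev: "levels V E v d" and v: "v \<notin> \<Union>F"
  obtains g where "\<And>f. f \<in> F \<Longrightarrow> g f \<in> E \<and> adjacent_edges f (g f)"
    and "\<And>f x y. f \<in> F \<Longrightarrow> {x, y} \<in> E \<Longrightarrow> x \<notin> \<Union>F \<Longrightarrow> y \<in> f \<Longrightarrow> d x < d y \<Longrightarrow> g f = {x, y}"
proof -
  have "\<exists>e. e \<in> E \<and> adjacent_edges f e \<and>
      (\<forall>x y. {x, y} \<in> E \<longrightarrow> x \<notin> \<Union>F \<longrightarrow> y \<in> f \<longrightarrow> d x < d y \<longrightarrow> e = {x, y})" if f: "f \<in> F" for f
  proof -
    have "f \<in> E" using f F_sub by auto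
    have "\<exists>s t. f = {s, t} \<and> d s = Suc (d t)"
    proof -
      obtain s t where st: "f = {s, t}" using card_edge[OF \<open>f \<in> E\<close>] by (auto simp: card_2_iff)
      then have "d s = Suc (d t) \<or> d t = Suc (d s)"
        using lev \<open>f \<in> E\<close> unfolding levels_def by metis
      then show ?thesis using st by (metis insert_commute)
    qed
    then obtain s t where st: "f = {s, t}" "d s = Suc (d t)" by blast
    have "{s, t} \<in> E" using st \<open>f \<in> E\<close> by simp
    have "t \<in> V" "t \<noteq> v" using edge_ends[OF \<open>{s, t} \<in> E\<close>] st f v by auto
    then obtain p where p: "{t, p} \<in> E" "d p < d t" using lev unfolding levels_def by metis
    have "p \<noteq> s" using p st by auto
    have "adjacent_edges f {t, p}"
      using adjacent_pairI[of s p t] \<open>p \<noteq> s\<close> st by (simp add: insert_commute)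
    moreover have "{t, p} = {x, y}" if xy: "{x, y} \<in> E" "x \<notin> \<Union>F" "y \<in> f" "d x < d y" for x y
    proof (cases "y = t")
      case True
      then have "x = p" using lev p xy unfolding levels_def by (metis insert_commute)
      then show ?thesis using True by auto
    next
      case False
      then have "y = s" using xy st by auto
      then have "x = t" using lev \<open>{s, t} \<in> E\<close> st xy unfolding levels_def by (metis insert_commute lessI)
      then show ?thesis using xy st f by auto
    qed
    ultimately show ?thesis using p by blast
  qed
  then obtain g where "\<forall>f\<in>F. g f \<in> E \<and> adjacent_edges f (g f) \<and>
      (\<forall>x y. {x, y} \<in> E \<longrightarrow> x \<notin> \<Union>F \<longrightarrow> y \<in> f \<longrightarrow> d x < d y \<longrightarrow> g f = {x, y})"
    by metis
  then show thesis by (intro that) auto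
qed

text \<open>The two clauses of the side condition, for a vertex \<open>v\<close> where at least two double stars
  meet; one of them contains \<open>uw\<close>, another one \<open>b\<close>. With \<open>g\<close> the entry edges for the root \<open>v\<close>:
  if \<open>w\<close> has no leaf, then \<open>F\<close> and all entry edges without \<open>uw\<close> still form a total edge dominating set,
  because the edges from \<open>w\<close> downwards end in vertices with children. If \<open>u\<close> has no leaf and \<open>w\<close> has a
  neighbour \<open>x \<noteq> u\<close> that is no leaf, then both \<open>uw\<close> and its entry edge \<open>vu\<close> can be replaced by the
  single edge \<open>wx\<close>. Either way the set has fewer than \<open>2 |F|\<close> edges.\<close>

lemma leaves_near_outer_vertex:
  assumes v: "v \<notin> \<Union>F" and vu: "{v, u} \<in> E" and vb: "{v, b} \<in> E" and ub: "u \<noteq> b"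
    and uw: "{u, w} \<in> F"
  shows "\<exists>y. {w, y} \<in> E \<and> is_leaf E y"
    and "(\<exists>y. {u, y} \<in> E \<and> is_leaf E y) \<or> (\<forall>y. {w, y} \<in> E \<longrightarrow> y \<noteq> u \<longrightarrow> is_leaf E y)"
proof -
  obtain d where lev: "levels V E v d" using tree_levels[OF tree] edge_ends[OF vu] by metis
  have edge: "d y = Suc (d x) \<or> d x = Suc (d y)" if "{x, y} \<in> E" for x y
    using lev that unfolding levels_def by metis
  have uniq: "y = z" if "{x, y} \<in> E" "{x, z} \<in> E" "d y < d x" "d z < d x" for x y z
    using lev that unfolding levels_def by metis
  have uwE: "{u, w} \<in> E" using uw F_sub by auto
  have dv: "d v = 0" using lev by (simp add: levels_def)
  have du: "d u = 1" and db: "d b = 1" using edge[OF vu] edge[OF vb] dv by auto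
  have "w \<noteq> v" using uw v by auto
  then have "d w \<noteq> 0" using lev edge_ends[OF uwE] unfolding levels_def by metis
  then have dw: "d w = 2" using edge[OF uwE] du by auto
  have bF: "b \<in> \<Union>F" using meets[OF vb v] .
  then obtain h where h: "h \<in> F" "b \<in> h" by blast
  have bw: "b \<noteq> w" using db dw by auto
  have hne: "h \<noteq> {u, w}" using h ub bw by auto
  obtain g where g: "\<And>f. f \<in> F \<Longrightarrow> g f \<in> E \<and> adjacent_edges f (g f)"
    and entry: "\<And>f x y. f \<in> F \<Longrightarrow> {x, y} \<in> E \<Longrightarrow> x \<notin> \<Union>F \<Longrightarrow> y \<in> f \<Longrightarrow> d x < d y \<Longrightarrow> g f = {x, y}"
    using entry_edges[OF lev v] by blast
  have gf: "g {u, w} = {v, u}" using entry[OF uw vu v] dv du by simp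
  \<comment> \<open>At the root \<open>v\<close>, the edge \<open>vu\<close> is dominated by the entry edge \<open>vb\<close> even if nothing else meets \<open>u\<close>.\<close>
  have gh: "g h = {v, b}" using entry[OF h(1) vb v h(2)] dv db by simp
  have outer: "x \<notin> \<Union>F" if "{w, x} \<in> E" "x \<noteq> u" for x
    using inner_edge[OF that(1)] uw mate_unique[of w x u] that by (auto simp: insert_commute)
  have outer': "x \<notin> \<Union>F" if "{u, x} \<in> E" "x \<noteq> w" for x
    using inner_edge[OF that(1)] uw mate_unique[of u x w] that by (auto simp: insert_commute)
  \<comment> \<open>An outer vertex that is no leaf has a child, and the edge to that child is an entry edge.\<close>
  have below: "\<exists>y f. y \<noteq> q \<and> f \<in> F \<and> y \<in> f \<and> g f = {x, y} \<and> d y = Suc (d x)"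
    if q: "{q, x} \<in> E" "d q < d x" "x \<notin> \<Union>F" "\<not> is_leaf E x" for q x
  proof -
    have xq: "{x, q} \<in> E" using q by (simp add: insert_commute)
    obtain y where y: "{x, y} \<in> E" "y \<noteq> q"
      using not_leaf_other_neighbour[OF q(4) xq] edge_ends[OF xq] by metis
    have dy: "d y = Suc (d x)" using edge[OF y(1)] uniq[OF xq y(1)] q y by fastforce
    obtain f where f: "f \<in> F" "y \<in> f" using meets[OF y(1) q(3)] by blast
    have "g f = {x, y}" using entry[OF f(1) y(1) q(3) f(2)] dy by simp
    then show ?thesis using f y dy by blast
  qed
  have wlev: "d w < d x" if "{w, x} \<in> E" "x \<noteq> u" for x
    using uniq[of w x u] edge[OF that(1)] that uwE du dw by (fastforce simp: insert_commute)
  have ulev: "d u < d x" if "{u, x} \<in> E" "x \<noteq> v" for x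
    using uniq[of u x v] edge[OF that(1)] that vu du dv by (fastforce simp: insert_commute)
  have other: "\<exists>f\<in>F - {{u, w}}. adjacent_edges e f" if "e \<in> E" "e \<notin> F" "u \<notin> e" "w \<notin> e" for e
  proof -
    from dominated[OF that(1,2)] obtain f where f: "f \<in> F" "adjacent_edges e f" by blast
    have "f \<noteq> {u, w}" using f that by (auto simp: adjacent_edges_def)
    then show ?thesis using f by blast
  qed
  have adjI: "adjacent_edges {q, x} {x, y}" if "y \<noteq> q" for q x y :: 'a
    using adjacent_pairI[of q y x] that by (simp add: insert_commute)
  show "\<exists>y. {w, y} \<in> E \<and> is_leaf E y"
  proof (rule ccontr)
    assume "\<nexists>y. {w, y} \<in> E \<and> is_leaf E y"
    then have noleaf: "\<not> is_leaf E y" if "{w, y} \<in> E" for y using that by blast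
    let ?K = "(F - {{u, w}}) \<union> g ` F"
    have "total_edge_dominating_set E ?K"
      unfolding total_edge_dominating_set_def
    proof (intro conjI ballI)
      show "?K \<subseteq> E" using F_sub g by auto
      fix e assume e: "e \<in> E"
      show "\<exists>f\<in>?K. adjacent_edges e f"
      proof (cases "e \<in> F")
        case True
        then show ?thesis using g by auto
      next
        case nF: False
        consider "u \<in> e" | "w \<in> e" "u \<notin> e" | "u \<notin> e" "w \<notin> e" by blast
        then show ?thesis
        proof cases
          case 1
          then obtain x where x: "e = {u, x}" using card2_other_end[OF card_edge[OF e]] by metis
          show ?thesis
          proof (cases "x = v")
            case True
            then have "adjacent_edges e (g h)" using x gh adjI[of b u v] ub by simp
            then show ?thesis using h by blast
          next
            case False
            then have "adjacent_edges e (g {u, w})"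
              using x gf adjacent_pairI[of x v u] by (simp add: insert_commute)
            then show ?thesis using uw by blast
          qed
        next
          case 2
          then obtain x where x: "e = {w, x}" using card2_other_end[OF card_edge[OF e]] by metis
          then have wx: "{w, x} \<in> E" "x \<noteq> u" using e 2 by auto
          obtain y f where "y \<noteq> w" "f \<in> F" "g f = {x, y}"
            using below[OF wx(1) wlev[OF wx] outer[OF wx] noleaf[OF wx(1)]] by blast
          then have "adjacent_edges e (g f)" using adjI x by simp
          then show ?thesis using \<open>f \<in> F\<close> by blast
        next
          case 3
          then show ?thesis using other[OF e nF] by blast
        qed
      qed
    qed
    then have "2 * card F \<le> card ?K" using sharp by (simp add: sharp_def)
    also have "\<dots> \<le> card (F - {{u, w}}) + card (g ` F)" by (rule card_Un_le)
    also have "\<dots> < 2 * card F"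
      using uw finite_F card_image_le[OF finite_F, of g] card_Diff1_less[OF finite_F uw] by simp
    finally show False by simp
  qed
  show "(\<exists>y. {u, y} \<in> E \<and> is_leaf E y) \<or> (\<forall>y. {w, y} \<in> E \<longrightarrow> y \<noteq> u \<longrightarrow> is_leaf E y)"
  proof (rule ccontr)
    assume neg: "\<not> ((\<exists>y. {u, y} \<in> E \<and> is_leaf E y) \<or> (\<forall>y. {w, y} \<in> E \<longrightarrow> y \<noteq> u \<longrightarrow> is_leaf E y))"
    then have noleaf: "\<not> is_leaf E y" if "{u, y} \<in> E" for y using that by blast
    from neg obtain x where x: "{w, x} \<in> E" "x \<noteq> u" "\<not> is_leaf E x" by blast
    let ?F = "F - {{u, w}}"
    let ?K = "insert {w, x} (?F \<union> g ` ?F)"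
    have "total_edge_dominating_set E ?K"
      unfolding total_edge_dominating_set_def
    proof (intro conjI ballI)
      show "?K \<subseteq> E" using F_sub g x by auto
      fix e assume e: "e \<in> E"
      consider "u \<in> e" | "w \<in> e" "u \<notin> e" | "u \<notin> e" "w \<notin> e" by blast
      then show "\<exists>f\<in>?K. adjacent_edges e f"
      proof cases
        case 1
        then obtain z where z: "e = {u, z}" using card2_other_end[OF card_edge[OF e]] by metis
        consider "z = v" | "z = w" | "z \<noteq> v" "z \<noteq> w" by blast
        then show ?thesis
        proof cases
          case 1
          then have "adjacent_edges e (g h)" using z gh adjI[of b u v] ub by simp
          then show ?thesis using h hne by blast
        next
          case 2
          then have "adjacent_edges e {w, x}" using z adjI[of x u w] x by simp
          then show ?thesis by blast
        next
          case 3
          have uz: "{u, z} \<in> E" using e z by simp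
          obtain y f where y: "y \<noteq> u" "f \<in> F" "y \<in> f" "g f = {z, y}" "d y = Suc (d z)"
            using below[OF uz ulev[OF uz 3(1)] outer'[OF uz 3(2)] noleaf[OF uz]] by blast
          then have "f \<noteq> {u, w}" using ulev[OF uz 3(1)] du dw by auto
          moreover have "adjacent_edges e (g f)" using adjI y z by simp
          ultimately show ?thesis using y by blast
        qed
      next
        case 2
        then obtain z where z: "e = {w, z}" using card2_other_end[OF card_edge[OF e]] by metis
        show ?thesis
        proof (cases "z = x")
          case False
          then have "adjacent_edges e {w, x}" using z adjacent_pairI by simp
          then show ?thesis by blast
        next
          case True
          obtain y f where y: "y \<noteq> w" "f \<in> F" "y \<in> f" "g f = {x, y}" "d y = Suc (d x)"
            using below[OF x(1) wlev[OF x(1,2)] outer[OF x(1,2)] x(3)] by blast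
          then have "f \<noteq> {u, w}" using wlev[OF x(1,2)] du dw by auto
          moreover have "adjacent_edges e (g f)" using adjI y z True by simp
          ultimately show ?thesis using y by blast
        qed
      next
        case 3
        show ?thesis
        proof (cases "e \<in> F")
          case True
          then have "e \<in> ?F" using 3 by auto
          then show ?thesis using g by blast
        next
          case False
          then show ?thesis using other[OF e False] 3 by blast
        qed
      qed
    qed
    then have "2 * card F \<le> card ?K" using sharp by (simp add: sharp_def)
    also have "\<dots> \<le> Suc (card (?F \<union> g ` ?F))" by (rule card_insert_le_m1) auto
    also have "card (?F \<union> g ` ?F) \<le> card ?F + card (g ` ?F)" by (rule card_Un_le)
    also have "card (g ` ?F) \<le> card ?F" using finite_F by (intro card_image_le) simp
    finally show False using card_Diff1_less[OF finite_F uw] by simp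
  qed
qed

end

section \<open>Growing a labelled tree by double stars\<close>

lemma connected_add_leaf:
  assumes c: "connected_graph V E" and v: "v \<in> V"
  shows "connected_graph (insert u V) (insert {v, u} E)"
proof -
  have joined: "\<exists>p. walk (insert u V) (insert {v, u} E) p \<and> hd p = x \<and> last p = y"
    if xy: "x \<in> V" "y \<in> V" for x y
  proof -
    obtain p where p: "walk V E p" "hd p = x" "last p = y"
      using c xy unfolding connected_graph_def by meson
    have "walk (insert u V) (insert {v, u} E) p"
      using p(1) successively_mono[of "\<lambda>x y. {x, y} \<in> E" p "\<lambda>x y. {x, y} \<in> insert {v, u} E"]
      by (auto simp: walk_def)
    then show ?thesis using p by blast
  qed
  have "\<exists>p. walk (insert u V) (insert {v, u} E) p \<and> hd p = x \<and> last p = y"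
    if xy: "x \<in> insert u V" "y \<in> insert u V" for x y
  proof -
    consider "x \<in> V" "y \<in> V" | "x = u" "y = u" | "x = u" "y \<in> V" | "x \<in> V" "y = u"
      using xy by blast
    then show ?thesis
    proof cases
      case 1 then show ?thesis by (rule joined)
    next
      case 2 then show ?thesis by (intro exI[of _ "[u]"]) (simp add: walk_def)
    next
      case 3
      then obtain p where p: "walk (insert u V) (insert {v, u} E) p" "hd p = v" "last p = y"
        using joined[OF v] by blast
      then have "p \<noteq> []" by (simp add: walk_def)
      then show ?thesis using p 3
        by (intro exI[of _ "u # p"]) (simp add: walk_Cons insert_commute)
    next
      case 4
      then obtain p where p: "walk (insert u V) (insert {v, u} E) p" "hd p = x" "last p = v"
        using joined[OF _ v] by blast
      then have "p \<noteq> []" by (simp add: walk_def)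
      then show ?thesis using p 4
        by (intro exI[of _ "p @ [u]"]) (simp add: walk_snoc)
    qed
  qed
  then show ?thesis by (auto simp: connected_graph_def)
qed

text \<open>A value of \<open>vdist\<close> tells something about walks only if the two vertices are joined by one.\<close>

lemma family_connected: "labelled_family V E l \<Longrightarrow> connected_graph V E"
proof (induction rule: labelled_family.induct)
  case (P4 a b c d l)
  have "connected_graph {a} {}"
    by (auto simp: connected_graph_def walk_def intro!: exI[of _ "[a]"])
  from connected_add_leaf[OF this, of a b] have "connected_graph {b, a} {{a, b}}" by simp
  from connected_add_leaf[OF this, of b c] have "connected_graph {c, b, a} {{b, c}, {a, b}}" by simp
  from connected_add_leaf[OF this, of c d]
  have "connected_graph {d, c, b, a} {{c, d}, {b, c}, {a, b}}" by simp
  moreover have "{d, c, b, a} = {a, b, c, d}" "{{c, d}, {b, c}, {a, b}} = {{a, b}, {b, c}, {c, d}}"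
    by auto
  ultimately show ?case by simp
next
  case (O1 V E l v b c d)
  from connected_add_leaf[OF O1.IH O1.hyps(2), of b]
  have "connected_graph (insert b V) (insert {v, b} E)" .
  from connected_add_leaf[OF this, of b c]
  have "connected_graph (insert c (insert b V)) (insert {b, c} (insert {v, b} E))" by simp
  from connected_add_leaf[OF this, of c d]
  have "connected_graph (insert d (insert c (insert b V)))
      (insert {c, d} (insert {b, c} (insert {v, b} E)))" by simp
  moreover have "insert d (insert c (insert b V)) = V \<union> {b, c, d}"
    "insert {c, d} (insert {b, c} (insert {v, b} E)) = E \<union> {{v, b}, {b, c}, {c, d}}" by auto
  ultimately show ?case by simp
next
  case (O2 V E l v u)
  show ?case by (rule connected_add_leaf[OF O2.IH O2.hyps(2)])
qed

lemma family_add_leaves: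
  assumes "finite X" "labelled_family V E l" "c \<in> V" "l c = C" "X \<inter> V = {}" "\<forall>x\<in>X. l x = L"
  shows "labelled_family (V \<union> X) (E \<union> (\<lambda>x. {c, x}) ` X) l"
  using assms(1,5,6)
proof (induction X)
  case empty
  then show ?case using assms by simp
next
  case (insert x X)
  then have "labelled_family (V \<union> X) (E \<union> (\<lambda>x. {c, x}) ` X) l" by simp
  from labelled_family.O2[OF this, of c x] insert assms
  have "labelled_family (insert x (V \<union> X)) (insert {c, x} (E \<union> (\<lambda>x. {c, x}) ` X)) (l(x := L))"
    by auto
  moreover have "l(x := L) = l" using insert by (auto simp: fun_eq_iff)
  ultimately show ?case by simp
qed

text \<open>Start from the path through one leaf on either side and add the other leaves singly.\<close>

lemma family_double_star:
  assumes "finite A" "finite D" "A \<noteq> {}" "D \<noteq> {}" "A \<inter> D = {}" "b \<noteq> c"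
    and "l b = C" "l c = C" "\<forall>x\<in>A \<union> D. l x = L"
  shows "labelled_family ({b, c} \<union> A \<union> D)
    (insert {b, c} ((\<lambda>x. {b, x}) ` A \<union> (\<lambda>x. {c, x}) ` D)) l"
proof -
  obtain a d where ad: "a \<in> A" "d \<in> D" using assms by auto
  have out: "b \<notin> A" "b \<notin> D" "c \<notin> A" "c \<notin> D" using assms by auto
  have "labelled_family {a, b, c, d} {{a, b}, {b, c}, {c, d}} l"
    by (rule labelled_family.P4) (use assms ad out in auto)
  then have "labelled_family ({a, b, c, d} \<union> (D - {d}))
      ({{a, b}, {b, c}, {c, d}} \<union> (\<lambda>x. {c, x}) ` (D - {d})) l"
    by (rule family_add_leaves[rotated]) (use assms ad out in auto)
  then have "labelled_family (({a, b, c, d} \<union> (D - {d})) \<union> (A - {a}))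
      (({{a, b}, {b, c}, {c, d}} \<union> (\<lambda>x. {c, x}) ` (D - {d})) \<union> (\<lambda>x. {b, x}) ` (A - {a})) l"
    by (rule family_add_leaves[rotated]) (use assms ad out in auto)
  moreover have "({a, b, c, d} \<union> (D - {d})) \<union> (A - {a}) = {b, c} \<union> A \<union> D"
    using ad by blast
  moreover have "({{a, b}, {b, c}, {c, d}} \<union> (\<lambda>x. {c, x}) ` (D - {d})) \<union> (\<lambda>x. {b, x}) ` (A - {a})
      = insert {b, c} ((\<lambda>x. {b, x}) ` A \<union> (\<lambda>x. {c, x}) ` D)"
    using ad by (auto simp: insert_commute)
  ultimately show ?thesis by simp
qed

text \<open>The attached path runs from \<open>v\<close> through \<open>b\<close> and \<open>c\<close> to some leaf in \<open>D\<close>; the other leaves follow singly.\<close>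

lemma family_attach_double_star:
  assumes fam: "labelled_family V E l" and v: "v \<in> V" "l v = L" "O1_condition V E l v"
    and "finite A" "finite D" "D \<noteq> {}" "A \<inter> D = {}" "b \<noteq> c" "b \<notin> V" "c \<notin> V"
    and "(A \<union> D) \<inter> V = {}" "l b = C" "l c = C" "\<forall>x\<in>A \<union> D. l x = L"
  shows "labelled_family (V \<union> {b, c} \<union> A \<union> D)
    (E \<union> {{v, b}, {b, c}} \<union> (\<lambda>x. {b, x}) ` A \<union> (\<lambda>x. {c, x}) ` D) l"
proof -
  obtain d where d: "d \<in> D" using assms by auto
  have out: "b \<notin> A" "b \<notin> D" "c \<notin> A" "c \<notin> D" using assms by auto
  have "labelled_family (V \<union> {b, c, d}) (E \<union> {{v, b}, {b, c}, {c, d}}) (l(b := C, c := C, d := L))"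
    by (rule labelled_family.O1[OF fam v]) (use assms d out in auto)
  moreover have "l(b := C, c := C, d := L) = l" using assms d by (auto simp: fun_eq_iff)
  ultimately have "labelled_family (V \<union> {b, c, d}) (E \<union> {{v, b}, {b, c}, {c, d}}) l" by simp
  then have "labelled_family ((V \<union> {b, c, d}) \<union> (D - {d}))
      ((E \<union> {{v, b}, {b, c}, {c, d}}) \<union> (\<lambda>x. {c, x}) ` (D - {d})) l"
    by (rule family_add_leaves[rotated]) (use assms d out in auto)
  then have "labelled_family (((V \<union> {b, c, d}) \<union> (D - {d})) \<union> A)
      (((E \<union> {{v, b}, {b, c}, {c, d}}) \<union> (\<lambda>x. {c, x}) ` (D - {d})) \<union> (\<lambda>x. {b, x}) ` A) l"
    by (rule family_add_leaves[rotated]) (use assms d out in auto)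
  moreover have "((V \<union> {b, c, d}) \<union> (D - {d})) \<union> A = V \<union> {b, c} \<union> A \<union> D"
    using d by blast
  moreover have "((E \<union> {{v, b}, {b, c}, {c, d}}) \<union> (\<lambda>x. {c, x}) ` (D - {d})) \<union> (\<lambda>x. {b, x}) ` A
      = E \<union> {{v, b}, {b, c}} \<union> (\<lambda>x. {b, x}) ` A \<union> (\<lambda>x. {c, x}) ` D"
    using d by auto
  ultimately show ?thesis by simp
qed

section \<open>Decomposing a tree into double stars\<close>

context sharp_tree
begin

definition lab :: "'a \<Rightarrow> label" where
  "lab x = (if x \<in> \<Union>F then C else L)"

text \<open>For \<open>G \<subseteq> F\<close> this is the union of the double stars around the edges of \<open>G\<close>.\<close>

definition edges_at :: "'a set set \<Rightarrow> 'a set set" where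
  "edges_at G = {e \<in> E. e \<inter> \<Union>G \<noteq> {}}"

lemma edges_at_pair: "{x, y} \<in> edges_at G \<longleftrightarrow> {x, y} \<in> E \<and> (x \<in> \<Union>G \<or> y \<in> \<Union>G)"
  by (auto simp: edges_at_def)

text \<open>An inner vertex has only one inner neighbour, its mate, so it can be an end of an edge at \<open>\<Union>G\<close> only
  together with its own edge of \<open>F\<close>.\<close>

lemma covered_inner:
  assumes G: "G \<subseteq> F" and x: "x \<in> \<Union>(edges_at G)" "x \<in> \<Union>F"
  shows "x \<in> \<Union>G"
proof -
  obtain e where e: "e \<in> E" "e \<inter> \<Union>G \<noteq> {}" "x \<in> e" using x by (auto simp: edges_at_def)
  obtain y where y: "e = {x, y}" using card2_other_end[OF card_edge[OF e(1)] e(3)] by blast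
  show ?thesis
  proof (cases "x \<in> \<Union>G")
    case False
    then obtain g where g: "y \<in> g" "g \<in> G" using e y by auto
    then have "{x, y} \<in> F" using inner_edge[of x y] e(1) y x(2) G by auto
    then have "{x, y} = g" using sharp_matching[OF sharp, of "{x, y}" g] g G by auto
    then show ?thesis using g by auto
  qed
qed

lemma leaf_edges_at: "{w, y} \<in> edges_at G \<Longrightarrow> is_leaf E y \<Longrightarrow> is_leaf (edges_at G) y"
proof -
  assume wy: "{w, y} \<in> edges_at G" and leaf: "is_leaf E y"
  have wyE: "{w, y} \<in> E" using wy by (simp add: edges_at_def)
  have "nbhd (edges_at G) y \<subseteq> nbhd E y" by (auto simp: nbhd_def edges_at_def)
  moreover have "w \<in> nbhd (edges_at G) y" using wy edge_ends[OF wyE] by (auto simp: nbhd_def insert_commute)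
  moreover obtain a where "nbhd E y = {a}" using leaf unfolding is_leaf_def by (rule card_1_singletonE)
  ultimately have "nbhd (edges_at G) y = {a}" by auto
  then show ?thesis by (simp add: is_leaf_def)
qed

text \<open>Leaves of the whole tree stay leaves in the partial tree, so the side conditions, known for the
  whole tree, pass to it. The double star of \<open>b\<close>, still to be attached, is the second one at \<open>v\<close>.\<close>

lemma O1_condition_edges_at:
  assumes G: "G \<subseteq> F" and fam: "labelled_family (\<Union>(edges_at G)) (edges_at G) lab"
    and v: "v \<notin> \<Union>F" and cov: "v \<in> \<Union>(edges_at G)" and vb: "{v, b} \<in> E" and b: "b \<in> \<Union>F" "b \<notin> \<Union>G"
  shows "O1_condition (\<Union>(edges_at G)) (edges_at G) lab v"
proof -
  have key: "(\<exists>y\<in>nbhd (edges_at G) w. is_leaf (edges_at G) y) \<and>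
      ((\<exists>y\<in>nbhd (edges_at G) u. y \<noteq> v \<and> is_leaf (edges_at G) y) \<or>
       (\<forall>y\<in>nbhd (edges_at G) w - {u}. is_leaf (edges_at G) y))"
    if uw: "{u, w} \<in> edges_at G" "w \<in> \<Union>F" and vu: "{v, u} \<in> edges_at G" for u w
  proof -
    have uwE: "{u, w} \<in> E" and vuE: "{v, u} \<in> E" using uw vu by (auto simp: edges_at_def)
    have uF: "u \<in> \<Union>F" using meets[OF vuE v] .
    have uwF: "{u, w} \<in> F" by (rule inner_edge[OF uwE uF uw(2)])
    have uG: "u \<in> \<Union>G" by (rule covered_inner[OF G _ uF]) (use uw in auto)
    have wG: "w \<in> \<Union>G" by (rule covered_inner[OF G _ uw(2)]) (use uw in auto)
    have ub: "u \<noteq> b" using uG b by auto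
    have at_u: "{u, y} \<in> edges_at G" if "{u, y} \<in> E" for y using that uG by (simp add: edges_at_pair)
    have at_w: "{w, y} \<in> edges_at G" if "{w, y} \<in> E" for y using that wG by (simp add: edges_at_pair)
    have v_no_leaf: "\<not> is_leaf E v"
      using leaf_neighbour_unique[of E v u b] vuE vb ub edge_ends[OF vuE] edge_ends[OF vb] by metis
    note near = leaves_near_outer_vertex[OF v vuE vb ub uwF]
    have ne: "x \<noteq> y" if "{x, y} \<in> E" for x y using edge_ends[OF that] by simp
    have "\<exists>y\<in>nbhd (edges_at G) w. is_leaf (edges_at G) y"
      using near(1) at_w leaf_edges_at ne unfolding nbhd_def by fastforce
    moreover have "(\<exists>y\<in>nbhd (edges_at G) u. y \<noteq> v \<and> is_leaf (edges_at G) y) \<or>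
       (\<forall>y\<in>nbhd (edges_at G) w - {u}. is_leaf (edges_at G) y)"
      using near(2)
    proof
      assume "\<exists>y. {u, y} \<in> E \<and> is_leaf E y"
      then obtain y where y: "{u, y} \<in> E" "is_leaf E y" by blast
      then have "y \<in> nbhd (edges_at G) u" "is_leaf (edges_at G) y" "y \<noteq> v"
        using at_u[OF y(1)] leaf_edges_at ne[OF y(1)] v_no_leaf by (auto simp: nbhd_def)
      then show ?thesis by blast
    next
      assume all: "\<forall>y. {w, y} \<in> E \<longrightarrow> y \<noteq> u \<longrightarrow> is_leaf E y"
      have "is_leaf (edges_at G) y" if "y \<in> nbhd (edges_at G) w - {u}" for y
      proof -
        have "{w, y} \<in> edges_at G" "y \<noteq> u" using that by (auto simp: nbhd_def)
        moreover from this have "is_leaf E y" using all by (auto simp: edges_at_def)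
        ultimately show ?thesis using leaf_edges_at by blast
      qed
      then show ?thesis by blast
    qed
    ultimately show ?thesis by blast
  qed
  show ?thesis
    unfolding O1_condition_def
  proof (intro conjI ballI impI)
    fix x assume x: "x \<in> \<Union>(edges_at G)" and "lab x = C \<and> vdist (\<Union>(edges_at G)) (edges_at G) v x = 2"
    then have xF: "x \<in> \<Union>F" and dist: "vdist (\<Union>(edges_at G)) (edges_at G) v x = 2"
      by (auto simp: lab_def split: if_splits)
    \<comment> \<open>The value 2 of the distance is attained by a walk of three vertices.\<close>
    obtain p where "walk (\<Union>(edges_at G)) (edges_at G) p" "hd p = v" "last p = x"
      using family_connected[OF fam] cov x unfolding connected_graph_def by meson
    then obtain q where q: "walk (\<Union>(edges_at G)) (edges_at G) q" "hd q = v" "last q = x" "length q = 3"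
      using vdist_walk dist by (metis eval_nat_numeral(3))
    then obtain u where "q = [v, u, x]" by (auto simp: length_Suc_conv numeral_3_eq_3)
    with q have "{v, u} \<in> edges_at G" "{u, x} \<in> edges_at G" by (auto simp: walk_def)
    then show "\<exists>y\<in>nbhd (edges_at G) x. is_leaf (edges_at G) y" using key xF by blast
  next
    fix w u assume "w \<in> \<Union>(edges_at G)" "u \<in> \<Union>(edges_at G)"
      and "{w, u} \<in> edges_at G \<and> lab w = C \<and> lab u = C \<and>
        edge_dist (\<Union>(edges_at G)) (edges_at G) v {w, u} = 1 \<and> {v, u} \<in> edges_at G"
    then show "(\<exists>y\<in>nbhd (edges_at G) u. y \<noteq> v \<and> is_leaf (edges_at G) y) \<or>
       (\<forall>y\<in>nbhd (edges_at G) w - {u}. is_leaf (edges_at G) y)"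
      using key[of u w] by (auto simp: lab_def insert_commute split: if_splits)
  qed
qed

text \<open>The level sum of an edge is \<open>2 * d b + 1\<close> for its end \<open>b\<close> nearer to the root.
  The double star of an edge with largest level sum in \<open>G\<close> is the last to be attached. Here
  \<open>b\<close> has an outer parent \<open>v\<close>, whose own parent lies on an edge of \<open>F\<close> of smaller level
  sum, so \<open>v\<close> is already present. Every other outer neighbour is a child of \<open>b\<close> or \<open>c\<close>; if it were
  present, one of its own children would lie on an edge of larger level sum in \<open>G\<close>. Hence the double
  star meets the rest in \<open>v\<close> only.\<close>

lemma family_edges_at:
  assumes lev: "levels V E r d" and root: "{r, c0} \<in> F"
  shows "G \<subseteq> F \<Longrightarrow> {r, c0} \<in> G \<Longrightarrow> (\<forall>f\<in>G. \<forall>g\<in>F. sum d g < sum d f \<longrightarrow> g \<in> G) \<Longrightarrow>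
    labelled_family (\<Union>(edges_at G)) (edges_at G) lab"
proof (induction "card G" arbitrary: G rule: less_induct)
  case less
  note G = less.prems(1) and rG = less.prems(2) and initial = less.prems(3)
  have edge: "d y = Suc (d x) \<or> d x = Suc (d y)" if "{x, y} \<in> E" for x y
    using lev that unfolding levels_def by metis
  have uniq: "y = z" if "{x, y} \<in> E" "{x, z} \<in> E" "d y < d x" "d z < d x" for x y z
    using lev that unfolding levels_def by metis
  have down: "\<exists>y. {x, y} \<in> E \<and> d y < d x" if "x \<in> V" "x \<noteq> r" for x
    using lev that unfolding levels_def by metis
  have sum_pair: "sum d {x, y} = d x + d y" if "{x, y} \<in> E" for x y
    using edge_ends[OF that] by simp
  have in_E: "f \<in> E" if "f \<in> F" for f using that F_sub by auto
  have nb_outer: "z \<notin> \<Union>F" if "{x, y} \<in> F" "{x, z} \<in> E" "z \<noteq> y" for x y z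
    using inner_edge[OF that(2)] mate_unique[OF that(1), of z] that by blast
  have pair_edges: "edges_at (insert {x, y} H) =
      edges_at H \<union> (\<lambda>z. {x, z}) ` nbhd E x \<union> (\<lambda>z. {y, z}) ` nbhd E y" for x y H
  proof (rule set_eqI)
    fix e
    show "e \<in> edges_at (insert {x, y} H) \<longleftrightarrow>
      e \<in> edges_at H \<union> (\<lambda>z. {x, z}) ` nbhd E x \<union> (\<lambda>z. {y, z}) ` nbhd E y" (is "?A \<longleftrightarrow> ?B")
    proof
      assume ?A
      then have e: "e \<in> E" "x \<in> e \<or> y \<in> e \<or> e \<inter> \<Union>H \<noteq> {}" by (auto simp: edges_at_def)
      then consider z where "e = {x, z}" | z where "e = {y, z}" | "e \<inter> \<Union>H \<noteq> {}"
        using card2_other_end[OF card_edge[OF e(1)]] by metis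
      then show ?B using e(1) by cases (auto simp: nbhd_iff edges_at_def)
    next
      assume ?B then show ?A by (auto simp: nbhd_iff edges_at_def)
    qed
  qed
  have split: "nbhd E x = insert y (nbhd E x - {y})" if "{x, y} \<in> E" for x y
    using that by (auto simp: nbhd_iff)
  show ?case
  proof (cases "G = {{r, c0}}")
    case True
    let ?A = "nbhd E r - {c0}" and ?D = "nbhd E c0 - {r}"
    have rE: "{r, c0} \<in> E" "{c0, r} \<in> E" using in_E[OF root] by (auto simp: insert_commute)
    have root': "{c0, r} \<in> F" using root by (simp add: insert_commute)
    have eq: "edges_at G = insert {r, c0} ((\<lambda>x. {r, x}) ` ?A \<union> (\<lambda>x. {c0, x}) ` ?D)"
    proof -
      have "edges_at G = edges_at {} \<union> (\<lambda>z. {r, z}) ` insert c0 ?A \<union> (\<lambda>z. {c0, z}) ` insert r ?D"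
        unfolding True using pair_edges[of r c0 "{}"] split[OF rE(1)] split[OF rE(2)] by metis
      moreover have "edges_at {} = {}" "{c0, r} = {r, c0}" by (auto simp: edges_at_def)
      ultimately show ?thesis by (simp del: insert_Diff_single)
    qed
    have cov: "\<Union>(edges_at G) = {r, c0} \<union> ?A \<union> ?D" unfolding eq by auto
    have inF: "r \<in> \<Union>F" "c0 \<in> \<Union>F" using root by auto
    obtain a where a: "{r, a} \<in> E" "a \<notin> \<Union>F" using outer_neighbour[OF inF(1)] by blast
    obtain b where b: "{c0, b} \<in> E" "b \<notin> \<Union>F" using outer_neighbour[OF inF(2)] by blast
    have disj: "?A \<inter> ?D = {}"
    proof -
      have "z \<notin> ?D" if "z \<in> ?A" for z
        using that edge[of r z] edge[of c0 z] edge[OF rE(1)] by (auto simp: nbhd_iff)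
      then show ?thesis by blast
    qed
    have outer: "z \<notin> \<Union>F" if "z \<in> ?A \<union> ?D" for z
      using that nb_outer[OF root, of z] nb_outer[OF root', of z] by (auto simp: nbhd_iff)
    have lab: "lab r = C" "lab c0 = C" "\<forall>x\<in>?A \<union> ?D. lab x = L"
      using inF outer unfolding lab_def by (metis (full_types))+
    show ?thesis unfolding cov unfolding eq
    proof (rule family_double_star)
      show "?A \<noteq> {}" "?D \<noteq> {}" using a b inF nbhd_iff by blast+
      show "r \<noteq> c0" using edge_ends[OF rE(1)] by simp
    qed (use finite_nbhd disj lab in simp_all)
  next
    case False
    have finG: "finite G" using G finite_F finite_subset by blast
    have dr: "d r = 0" using lev by (simp add: levels_def)
    have s0: "sum d {r, c0} = 1" using sum_pair[OF in_E[OF root]] edge[OF in_E[OF root]] dr by auto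
    obtain f where f: "f \<in> G - {{r, c0}}" "\<And>h. h \<in> G - {{r, c0}} \<Longrightarrow> sum d h \<le> sum d f"
    proof -
      let ?S = "G - {{r, c0}}"
      have S: "finite ?S" "?S \<noteq> {}" using finG False rG by auto
      have "Max (sum d ` ?S) \<in> sum d ` ?S" using S by (intro Max_in) auto
      then obtain f where f: "Max (sum d ` ?S) = sum d f" "f \<in> ?S" by (rule imageE)
      show thesis
      proof (rule that[OF f(2)])
        show "sum d h \<le> sum d f" if "h \<in> ?S" for h
          unfolding f(1)[symmetric] using S(1) that by (intro Max_ge) auto
      qed
    qed
    have fF: "f \<in> F" using f G by auto
    obtain b c where bc: "f = {b, c}" "d c = Suc (d b)"
    proof -
      obtain x y where "f = {x, y}" using card_edge[OF in_E[OF fF]] by (auto simp: card_2_iff)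
      moreover from this have "d y = Suc (d x) \<or> d x = Suc (d y)" using edge in_E[OF fF] by auto
      ultimately show thesis using that by (metis insert_commute)
    qed
    have bcF: "{b, c} \<in> F" "{c, b} \<in> F" and bcE: "{b, c} \<in> E" "{c, b} \<in> E"
      using bc fF in_E[OF fF] by (auto simp: insert_commute)
    have sf: "sum d f = 2 * d b + 1" using bc sum_pair[OF bcE(1)] by simp
    have max: "sum d h \<le> sum d f" if "h \<in> G" for h using f(2)[of h] that s0 sf by fastforce
    have "b \<noteq> r" using sharp_matching[OF sharp fF root] f bc by auto
    then obtain v where v: "{b, v} \<in> E" "d v < d b" using down[of b] edge_ends[OF bcE(1)] by blast
    have "v \<noteq> c" using v bc by auto
    then have vF: "v \<notin> \<Union>F" using nb_outer[OF bcF(1) v(1)] by simp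
    have vb: "{v, b} \<in> E" "d b = Suc (d v)" using v edge[OF v(1)] by (auto simp: insert_commute)
    let ?H = "G - {f}"
    have H: "?H \<subseteq> F" using G by auto
    have fam: "labelled_family (\<Union>(edges_at ?H)) (edges_at ?H) lab"
    proof (rule less.hyps[OF _ H])
      show "card ?H < card G" using f finG by (intro card_Diff1_less) auto
      show "{r, c0} \<in> ?H" using f rG by auto
      show "\<forall>h\<in>?H. \<forall>g\<in>F. sum d g < sum d h \<longrightarrow> g \<in> ?H"
        using initial max by (metis DiffD1 DiffI leD singletonD)
    qed
    have vcov: "v \<in> \<Union>(edges_at ?H)"
    proof -
      have "v \<noteq> r" using vF root by auto
      then obtain t where t: "{v, t} \<in> E" "d t < d v" using down[of v] edge_ends[OF vb(1)] by blast
      obtain g where g: "t \<in> g" "g \<in> F" using meets[OF t(1) vF] by blast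
      obtain t' where t': "g = {t, t'}" using mate[OF g] by blast
      have "d t' \<le> Suc (d t)" using edge[of t t'] in_E[OF g(2)] t' by auto
      then have "sum d g < sum d f" using t' sum_pair[of t t'] in_E[OF g(2)] t vb sf by auto
      then have "g \<in> ?H" using initial f g by auto
      then have "{v, t} \<in> edges_at ?H" using t g by (auto simp: edges_at_pair)
      then show ?thesis by blast
    qed
    have fH: "x \<notin> \<Union>?H" if "x \<in> f" for x
      using sharp_matching[OF sharp fF] H that by blast
    have new: "b \<notin> \<Union>(edges_at ?H)" "c \<notin> \<Union>(edges_at ?H)"
      using covered_inner[OF H] fH bc fF by blast+
    have O1c: "O1_condition (\<Union>(edges_at ?H)) (edges_at ?H) lab v"
      by (rule O1_condition_edges_at[OF H fam vF vcov vb(1)]) (use fH bc fF in auto)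
    let ?A = "nbhd E b - {c, v}" and ?D = "nbhd E c - {b}"
    have up: "\<exists>q\<in>{b, c}. {z, q} \<in> E \<and> d q < d z" if "z \<in> ?A \<union> ?D" for z
      using that
    proof
      assume z: "z \<in> ?A"
      then have "d b < d z" using edge[of b z] uniq[of b z v] v by (force simp: nbhd_iff)
      then show ?thesis using z by (auto simp: nbhd_iff insert_commute)
    next
      assume z: "z \<in> ?D"
      then have "d c < d z" using edge[of c z] uniq[of c z b] bc bcE by (force simp: nbhd_iff)
      then show ?thesis using z by (auto simp: nbhd_iff insert_commute)
    qed
    have outer: "z \<notin> \<Union>F" if "z \<in> ?A \<union> ?D" for z
      using that nb_outer[OF bcF(1), of z] nb_outer[OF bcF(2), of z] by (auto simp: nbhd_iff)
    have fresh: "z \<notin> \<Union>(edges_at ?H)" if z: "z \<in> ?A \<union> ?D" for z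
    proof
      assume "z \<in> \<Union>(edges_at ?H)"
      then obtain e where e: "e \<in> E" "z \<in> e" "e \<inter> \<Union>?H \<noteq> {}" by (auto simp: edges_at_def)
      obtain t where t: "e = {z, t}" using card2_other_end[OF card_edge[OF e(1)] e(2)] by blast
      have "z \<notin> \<Union>?H" using outer[OF z] H by blast
      then obtain g where g: "g \<in> ?H" "t \<in> g" using e t by auto
      obtain q where q: "q \<in> {b, c}" "{z, q} \<in> E" "d q < d z" using up[OF z] by blast
      have "t \<noteq> q" using q fH[of q] bc g by blast
      then have "d z < d t" using uniq[of z t q] edge[of z t] e t q by fastforce
      moreover have "d q \<ge> d b" using q bc by auto
      ultimately have dt: "d t \<ge> d b + 2" using q by simp
      have gF: "g \<in> F" using g H by blast
      obtain t' where t': "g = {t, t'}" using mate[OF g(2) gF] by blast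
      have "d t \<le> Suc (d t')" using edge[of t t'] in_E[OF gF] t' by auto
      then have "sum d g > sum d f" using t' sum_pair[of t t'] in_E[OF gF] dt sf by auto
      then show False using max[of g] g by auto
    qed
    have disj: "?A \<inter> ?D = {}"
    proof -
      have "z \<notin> ?D" if "z \<in> ?A" for z
        using that edge[of b z] edge[of c z] edge[OF bcE(1)] by (auto simp: nbhd_iff)
      then show ?thesis by blast
    qed
    have Dne: "?D \<noteq> {}"
    proof -
      have "c \<in> \<Union>F" "b \<in> \<Union>F" using bcF by auto
      then obtain z where "{c, z} \<in> E" "z \<notin> \<Union>F" using outer_neighbour by blast
      then have "z \<in> ?D" using \<open>b \<in> \<Union>F\<close> by (auto simp: nbhd_iff)
      then show ?thesis by blast
    qed
    have eq: "edges_at G = edges_at ?H \<union> {{v, b}, {b, c}} \<union> (\<lambda>x. {b, x}) ` ?A \<union> (\<lambda>x. {c, x}) ` ?D"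
    proof -
      have "G = insert {b, c} ?H" using f bc by auto
      moreover have "nbhd E b = insert c (insert v ?A)" "nbhd E c = insert b ?D"
        using v bcE by (auto simp: nbhd_iff)
      ultimately have "edges_at G =
          edges_at ?H \<union> (\<lambda>z. {b, z}) ` insert c (insert v ?A) \<union> (\<lambda>z. {c, z}) ` insert b ?D"
        using pair_edges[of b c ?H] by metis
      moreover have "{b, v} = {v, b}" "{c, b} = {b, c}" by auto
      moreover have "X \<union> insert p (insert q Y) \<union> insert p Z = X \<union> {q, p} \<union> Y \<union> Z"
        for X Y Z and p q :: "'a set" by blast
      ultimately show ?thesis by (simp del: insert_Diff_single)
    qed
    have cov: "\<Union>(edges_at G) = \<Union>(edges_at ?H) \<union> {b, c} \<union> ?A \<union> ?D"
      unfolding eq using vcov by auto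
    show ?thesis unfolding cov unfolding eq
    proof (rule family_attach_double_star[OF fam vcov _ O1c])
      show "(?A \<union> ?D) \<inter> \<Union>(edges_at ?H) = {}" using fresh by blast
      show "\<forall>x\<in>?A \<union> ?D. lab x = L" using outer unfolding lab_def by (metis (full_types))
      show "lab v = L" using vF by (simp add: lab_def)
      show "lab b = C" "lab c = C" using bcF by (auto simp: lab_def)
      show "b \<noteq> c" using edge_ends[OF bcE(1)] by simp
    qed (use finite_nbhd disj Dne new in simp_all)
  qed
qed

lemma in_family: "labelled_family V E lab"
proof -
  have "\<not> card V \<le> Suc 0" using big by simp
  then obtain x y where xy: "x \<in> V" "y \<in> V" "x \<noteq> y"
    using card_le_Suc0_iff_eq[OF finite_V] by blast
  have no_isolated: "\<exists>e\<in>E. x \<in> e" if x: "x \<in> V" for x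
  proof (rule ccontr)
    assume n: "\<not> (\<exists>e\<in>E. x \<in> e)"
    have "V \<subseteq> {x}" by (rule closed_under_edges[OF conn _ x]) (use n in auto)
    then show False using xy by blast
  qed
  then obtain e where "e \<in> E" using xy by blast
  then obtain f where f: "f \<in> F" using sharp_meets[OF sharp] by blast
  obtain r c0 where rc: "f = {r, c0}" using card_edge[of f] F_sub f by (auto simp: card_2_iff)
  then have "r \<in> V" using edge_ends[of r c0] f F_sub by auto
  then obtain d where d: "levels V E r d" using tree_levels[OF tree] by blast
  have "labelled_family (\<Union>(edges_at F)) (edges_at F) lab"
    by (rule family_edges_at[OF d]) (use f rc in auto)
  moreover have "edges_at F = E" using sharp_meets[OF sharp] by (auto simp: edges_at_def)
  moreover have "\<Union>E = V"
    using no_isolated tree by (auto simp: tree_def simple_graph_def)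
  ultimately show ?thesis by simp
qed

end

section \<open>The characterization\<close>

theorem theorem4p2:
  fixes V :: "'a set" and E :: "'a set set"
  assumes "tree V E" and "card V \<ge> 2" and "\<not> star V E"
  shows "total_edge_domination_number E = 2 * edge_domination_number E
    \<longleftrightarrow> (\<exists>l. labelled_family V E l)"
proof -
  have sub: "E \<subseteq> Pow V" and fin: "finite V" and c2: "\<forall>e\<in>E. card e = 2"
    using assms(1) by (auto simp: tree_def simple_graph_def)
  have finE: "finite E" by (rule finite_subset[OF sub]) (simp add: fin)
  have "(\<exists>F. sharp E F) \<longleftrightarrow> (\<exists>l. labelled_family V E l)"
  proof
    assume "\<exists>F. sharp E F"
    then obtain F where F: "sharp E F" ..
    interpret sharp_tree V E F by unfold_locales (fact assms F)+
    show "\<exists>l. labelled_family V E l" using in_family by blast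
  next
    assume "\<exists>l. labelled_family V E l"
    then show "\<exists>F. sharp E F" using family_sharp by blast
  qed
  then show ?thesis using sharp_exists_iff[OF finE c2] by simp
qed

end
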